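(* Let $f:\mathbb{R}^d\to\mathbb{R}$ and $\mathbf{c}:\mathbb{R}^d\to\mathbb{R}^c$ be twice continuously differentiable, let $(\varepsilon_c,\varepsilon_p)\in(0,1)^2$, and run the Direct Primal-Dual Newton-MR Algorithm (described in the context). Let $\mathcal{X}$ denote the set containing all iterates and trial points generated by the algorithm, and suppose: (i) there are constants $0<\sigma_J\le\kappa_J<\infty$ such that $\sigma_J\le\sigma_c(x)\le\sigma_1(x)\le\kappa_J$ for all $x\in\mathcal{X}$, where $\sigma_1(x)$ and $\sigma_c(x)$ are the largest and the $c$-th largest singular values of the Jacobian $J(x)$; (ii) on $\mathcal{X}$, $\nabla f$ is $L_f$-Lipschitz continuous, $J$ is $L_c$-Lipschitz continuous, and $f$ is bounded below by $f_{\mathrm{low}}$; (iii) $\|\nabla f(x)\|\le\kappa_g$ for all $x\in\mathcal{X}$; (iv) $\|\mathbf{c}(x)\|\le\kappa_c$ for all $x\in\mathcal{X}$. Then the algorithm reaches a point $x_k$ satisfying $$\|\mathbf{c}(x_k)\|\le\varepsilon_c\quad\text{and}\quad\|P_{\mathcal{N}(J(x_k))}\nabla f(x_k)\|\le\varepsilon_p$$ in at most $$K=\left\lceil\frac{(f(x_0)-f_{\mathrm{low}})/\pi_{-1}+\|\mathbf{c}(x_0)\|}{\min\{\Gamma_c,\Gamma_p\}\,\min\{\varepsilon_c,\varepsilon_p^2\}}\right\rceil+1$$ iterations, where $\Gamma_c,\Gamma_p>0$ are the constants $$\Gamma_c=\bar\alpha\,\eta\,\rho,\qquad \Gamma_p=\frac{\bar\alpha\,\eta\,\gamma_{\tan}\,\omega_{\tan}^2}{\bar\pi},$$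 $$\gamma_{\tan}=\min\{1,\sigma\},\qquad \omega_{\tan}=\min\left\{\frac{\sigma}{\kappa_{\mathcal L}^2},\frac{\tau_{\tan}}{\sqrt{\tau_{\tan}^2+\kappa_{\mathcal L}^2}}\right\},\qquad \bar\pi=\max\left\{\frac{\kappa_g}{(1-\rho)\sigma_J},\pi_{-1}\right\},$$ $$\bar\alpha=\min\left\{1,\ \theta\,\frac{2(1-\eta)\min\{\gamma_{\tan},\pi_{-1}\rho\}}{(\bar\pi L_c+L_f)\max\{1,\kappa_c/\sigma_J^2\}}\right\},$$ and $\kappa_{\mathcal L}$ is a uniform bound on the Lagrangian Hessian, $\|\nabla^2_{xx}\mathcal{L}(x_k,\lambda_{k+1})\|\le\kappa_{\mathcal L}$ for all $k$ (the existence of which is a consequence of (i)-(iii)).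
   Context: Notation. $J(x)\in\mathbb{R}^{c\times d}$ is the Jacobian of $\mathbf{c}$; $\mathcal{L}(x,\lambda)=f(x)+\langle\lambda,\mathbf{c}(x)\rangle$; $\|\cdot\|$ is the Euclidean norm for vectors and the operator norm for matrices; $A^\dagger$ is the Moore-Penrose pseudoinverse and $A^\ddagger=(A^\dagger)^\top$; $P_{\mathcal{N}(J)}=I-J^\dagger J$ is the orthogonal projector onto the null space of $J$. Subscript $k$ means evaluation at $x_k$, e.g. $J_k=J(x_k)$, $\mathbf{c}_k=\mathbf{c}(x_k)$, $\nabla f_k=\nabla f(x_k)$. Merit function: $\phi(x;\pi)=f(x)+\pi\|\mathbf{c}(x)\|$. Also $$\bar D(x,p;\pi)=\langle\nabla f(x),p\rangle+\pi\big(\|\mathbf{c}(x)+J(x)p\|-\|\mathbf{c}(x)\|\big).$$ Projected CR (direct termination). Inputs: symmetric $H\in\mathbb{R}^{d\times d}$, $g\in\mathbb{R}^d$, an orthogonal projection $P=ZZ^\top$ ($Z$ with orthonormal columns), $\sigma>0$, $\tau_{\tan}>0$. Put $\bar H=Z^\top HZ$, $\bar g=Z^\top g$, $\bar d^{(0)}=0$, $\bar r^{(0)}=y^{(0)}=-\bar g$. If $\langle\bar r^{(0)},\bar H\bar r^{(0)}\rangle\le(d+1)\sigma\|\bar r^{(0)}\|^2$, return $Z\bar r^{(0)}$ (flag LPC). Otherwise, for $t=1,2,\dots$: $\zeta_{t-1}=\langle\bar r^{(t-1)},\bar H\bar r^{(t-1)}\rangle/\|\bar Hy^{(t-1)}\|^2$,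 $\bar d^{(t)}=\bar d^{(t-1)}+\zeta_{t-1}y^{(t-1)}$, $\bar r^{(t)}=\bar r^{(t-1)}-\zeta_{t-1}\bar Hy^{(t-1)}$, $\beta_{t-1}=\langle\bar r^{(t)},\bar H\bar r^{(t)}\rangle/\langle\bar r^{(t-1)},\bar H\bar r^{(t-1)}\rangle$, $y^{(t)}=\bar r^{(t)}+\beta_{t-1}y^{(t-1)}$; then, if $\|\bar H\bar r^{(t)}\|\le\tau_{\tan}\|\bar H\bar d^{(t)}\|$, return $Z\bar d^{(t)}$ (flag SOL); else if $\langle\bar r^{(t)},\bar H\bar r^{(t)}\rangle\le(d+1)\sigma\|\bar r^{(t)}\|^2$, return $Z\bar r^{(t)}$ (flag LPC); else continue. Direct Primal-Dual Newton-MR Algorithm. Parameters: $(\varepsilon_c,\varepsilon_p)\in(0,1)^2$, $\tau_{\tan}\in(0,1)$, $\sigma>0$, initial point $(x_0,\lambda_0)$, $\pi_{-1}>0$, $\rho,\eta,\theta\in(0,1)$. For $k=0,1,2,\dots$: 1. Set $v_k=-J_k^\dagger\mathbf{c}_k$ and $P_k=P_{\mathcal{N}(J_k)}$. 2. If $\|P_k\nabla f_k\|\le\varepsilon_p$ and $\|\mathbf{c}_k\|\le\varepsilon_c$, stop and return $x_k$. 3. Choose $\lambda_{k+1}$ to be either $0$ or the least-squares multiplier $-J_k^\ddagger\nabla f_k$. 4. Let $w_k$ be the vector returned by projected CR (direct termination) with $H=\nabla^2_{xx}\mathcal{L}(x_k,\lambda_{k+1})$, $g=\nabla f_k$, $P=P_k$,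 $\sigma$, $\tau_{\tan}$. 5. Set $\pi_k^{\mathrm{trial}}=\langle\nabla f_k,v_k\rangle/((1-\rho)\|\mathbf{c}_k\|)$ if $\mathbf{c}_k\ne0$ and $\pi_k^{\mathrm{trial}}=0$ otherwise; $\pi_k=\max\{\pi_k^{\mathrm{trial}},\pi_{k-1}\}$. 6. Set $p_k=v_k+w_k$ and, by backtracking over $\alpha\in\{1,\theta,\theta^2,\dots\}$, take $\alpha_k$ to be the first $\alpha$ with $\phi(x_k+\alpha p_k;\pi_k)\le\phi(x_k;\pi_k)+\alpha\eta\,\bar D(x_k,p_k;\pi_k)$. 7. Set $x_{k+1}=x_k+\alpha_kp_k$.
   Formalization: Lipschitz continuity in (ii) is assumed on a set D containing X and the segments [x_k, x_k+p_k], not only on X; existence of κ_L is stated for open D; a zero denominator in ω_tan or ᾱ is read as giving ∞. *)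

theory Defs
  imports "HOL-Analysis.Analysis" "HOL-Library.Multiset"
begin

section \<open>Derivatives\<close>

definition grad :: "(real^'d \<Rightarrow> real) \<Rightarrow> real^'d \<Rightarrow> real^'d" where
  "grad f x = (THE g. GDERIV f x :> g)"

definition hess :: "(real^'d \<Rightarrow> real) \<Rightarrow> real^'d \<Rightarrow> real^'d^'d" where
  "hess f x = jacobian (grad f) (at x)"

definition C2 :: "(real^'d \<Rightarrow> real) \<Rightarrow> bool" where
  "C2 f \<longleftrightarrow> (\<forall>x. f differentiable (at x)) \<and> (\<forall>x. grad f differentiable (at x)) \<and>
     continuous_on UNIV (hess f)"

abbreviation Jac :: "(real^'d \<Rightarrow> real^'c) \<Rightarrow> real^'d \<Rightarrow> real^'d^'c" where
  "Jac c x \<equiv> jacobian c (at x)"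

definition lagrangian :: "(real^'d \<Rightarrow> real) \<Rightarrow> (real^'d \<Rightarrow> real^'c) \<Rightarrow> real^'d \<Rightarrow> real^'c \<Rightarrow> real" where
  "lagrangian f c x l = f x + l \<bullet> c x"


section \<open>Matrices\<close>

text \<open>The norm of the type \<^typ>\<open>real^'n^'m\<close> is the Frobenius norm, so the operator norm has to
  be written explicitly.\<close>

definition opnorm :: "real^'n^'m \<Rightarrow> real" where
  "opnorm A = onorm (\<lambda>v. A *v v)"

definition pinv :: "real^'n^'m \<Rightarrow> real^'m^'n" where
  "pinv A = (THE B. A ** B ** A = A \<and> B ** A ** B = B \<and>
     transpose (A ** B) = A ** B \<and> transpose (B ** A) = B ** A)"

definition null_proj :: "real^'n^'m \<Rightarrow> real^'n^'n" where
  "null_proj A = mat 1 - pinv A ** A"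

definition eigenspace :: "real^'n^'n \<Rightarrow> real \<Rightarrow> (real^'n) set" where
  "eigenspace M \<mu> = {v. M *v v = \<mu> *\<^sub>R v}"

text \<open>The singular values of an \<open>m \<times> n\<close> matrix \<open>A\<close> are the square roots of the \<open>m\<close> eigenvalues of
  \<open>A A\<^sup>T\<close>, listed with multiplicity in decreasing order. The nonzero ones are the same as those
  obtained from \<open>A\<^sup>T A\<close>; if \<open>m > n\<close>, the list is padded by \<open>m - n\<close> zeros. As \<open>A A\<^sup>T\<close> is
  symmetric, the multiplicity of an eigenvalue is the dimension of its eigenspace.\<close>

definition singular_values :: "real^'n^'m \<Rightarrow> real list" where
  "singular_values A = (let M = A ** transpose A in
     rev (sorted_list_of_multiset (image_mset sqrt
       (\<Sum>\<mu> | eigenspace M \<mu> \<noteq> {0}. replicate_mset (dim (eigenspace M \<mu>)) \<mu>))))"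

definition singular_value :: "real^'n^'m \<Rightarrow> nat \<Rightarrow> real" where
  "singular_value A i =
     (if 1 \<le> i \<and> i \<le> length (singular_values A) then singular_values A ! (i - 1) else 0)"


section \<open>Projected conjugate residuals\<close>

text \<open>The matrix \<open>Z\<close> is given by the list of its columns, because their number \<open>m\<close> (the rank of
  the projection) depends on the run and may be \<open>0\<close>. Accordingly, vectors of \<open>\<real>\<^sup>m\<close> are functions
  on \<^typ>\<open>nat\<close> of which only the values below \<open>m\<close> matter, and \<open>m \<times> m\<close> matrices likewise.\<close>

definition is_orthonormal_factor :: "(real^'d) list \<Rightarrow> real^'d^'d \<Rightarrow> bool" where
  "is_orthonormal_factor Z P \<longleftrightarrow>
     (\<forall>i<length Z. \<forall>j<length Z. Z ! i \<bullet> Z ! j = (if i = j then 1 else 0)) \<and>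
     P = (\<chi> a b. \<Sum>i<length Z. (Z ! i) $ a * (Z ! i) $ b)"

definition ip :: "nat \<Rightarrow> (nat \<Rightarrow> real) \<Rightarrow> (nat \<Rightarrow> real) \<Rightarrow> real" where
  "ip m u v = (\<Sum>i<m. u i * v i)"

definition nrm :: "nat \<Rightarrow> (nat \<Rightarrow> real) \<Rightarrow> real" where
  "nrm m u = sqrt (ip m u u)"

definition mv :: "nat \<Rightarrow> (nat \<Rightarrow> nat \<Rightarrow> real) \<Rightarrow> (nat \<Rightarrow> real) \<Rightarrow> nat \<Rightarrow> real" where
  "mv m A u = (\<lambda>i. \<Sum>j<m. A i j * u j)"

definition restrict_mat :: "(real^'d) list \<Rightarrow> real^'d^'d \<Rightarrow> nat \<Rightarrow> nat \<Rightarrow> real" where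
  "restrict_mat Z H = (\<lambda>i j. Z ! i \<bullet> (H *v (Z ! j)))"

definition restrict_vec :: "(real^'d) list \<Rightarrow> real^'d \<Rightarrow> nat \<Rightarrow> real" where
  "restrict_vec Z g = (\<lambda>i. Z ! i \<bullet> g)"

definition lift_vec :: "(real^'d) list \<Rightarrow> (nat \<Rightarrow> real) \<Rightarrow> real^'d" where
  "lift_vec Z u = (\<Sum>i<length Z. u i *\<^sub>R Z ! i)"

text \<open>The triple \<open>(d, r, y)\<close> after \<open>t\<close> updates, without regard to the termination tests.\<close>

primrec cr_iter :: "nat \<Rightarrow> (nat \<Rightarrow> nat \<Rightarrow> real) \<Rightarrow> (nat \<Rightarrow> real) \<Rightarrow> nat \<Rightarrow>
    (nat \<Rightarrow> real) \<times> (nat \<Rightarrow> real) \<times> (nat \<Rightarrow> real)" where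
  "cr_iter m A b 0 = (\<lambda>i. 0, \<lambda>i. - b i, \<lambda>i. - b i)"
| "cr_iter m A b (Suc t) =
    (let (d, r, y) = cr_iter m A b t;
         \<zeta> = ip m r (mv m A r) / (nrm m (mv m A y))\<^sup>2;
         d' = (\<lambda>i. d i + \<zeta> * y i);
         r' = (\<lambda>i. r i - \<zeta> * mv m A y i);
         \<beta> = ip m r' (mv m A r') / ip m r (mv m A r)
     in (d', r', \<lambda>i. r' i + \<beta> * y i))"

text \<open>The result is \<^const>\<open>None\<close> if no termination test ever succeeds.\<close>

definition projected_cr ::
    "real^'d^'d \<Rightarrow> real^'d \<Rightarrow> (real^'d) list \<Rightarrow> real \<Rightarrow> real \<Rightarrow> (real^'d) option" where
  "projected_cr H g Z \<sigma> \<tau> =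
    (let m = length Z;
         A = restrict_mat Z H;
         d = (\<lambda>t. fst (cr_iter m A (restrict_vec Z g) t));
         r = (\<lambda>t. fst (snd (cr_iter m A (restrict_vec Z g) t)));
         lpc = (\<lambda>t. ip m (r t) (mv m A (r t)) \<le> (real CARD('d) + 1) * \<sigma> * (nrm m (r t))\<^sup>2);
         sol = (\<lambda>t. nrm m (mv m A (r t)) \<le> \<tau> * nrm m (mv m A (d t)));
         halt = (\<lambda>t. 1 \<le> t \<and> (sol t \<or> lpc t))
     in if lpc 0 then Some (lift_vec Z (r 0))
        else if \<exists>t. halt t then
          (let t = (LEAST t. halt t)
           in Some (if sol t then lift_vec Z (d t) else lift_vec Z (r t)))
        else None)"


section \<open>The direct primal-dual Newton-MR algorithm\<close>

definition merit :: "(real^'d \<Rightarrow> real) \<Rightarrow> (real^'d \<Rightarrow> real^'c) \<Rightarrow> real^'d \<Rightarrow> real \<Rightarrow> real" where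
  "merit f c x \<pi> = f x + \<pi> * norm (c x)"

definition Dbar :: "(real^'d \<Rightarrow> real) \<Rightarrow> (real^'d \<Rightarrow> real^'c) \<Rightarrow> real^'d \<Rightarrow> real^'d \<Rightarrow> real \<Rightarrow> real" where
  "Dbar f c x p \<pi> = grad f x \<bullet> p + \<pi> * (norm (c x + Jac c x *v p) - norm (c x))"

record ('d::finite, 'c::finite) dpd_params =
  eps_c :: real
  eps_p :: real
  tau_tan :: real
  sigma :: real
  rho :: real
  eta :: real
  theta :: real
  x_init :: "real^'d"
  lam_init :: "real^'c"
  pi_init :: real

definition valid_params :: "('d::finite, 'c::finite) dpd_params \<Rightarrow> bool" where
  "valid_params A \<longleftrightarrow> eps_c A \<in> {0<..<1} \<and> eps_p A \<in> {0<..<1} \<and> tau_tan A \<in> {0<..<1} \<and>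
     sigma A > 0 \<and> rho A \<in> {0<..<1} \<and> eta A \<in> {0<..<1} \<and> theta A \<in> {0<..<1} \<and> pi_init A > 0"

definition dpd_stop ::
    "('d, 'c) dpd_params \<Rightarrow> (real^'d \<Rightarrow> real) \<Rightarrow> (real^'d \<Rightarrow> real^'c) \<Rightarrow> real^'d \<Rightarrow> bool" where
  "dpd_stop A f c x \<longleftrightarrow>
     norm (null_proj (Jac c x) *v grad f x) \<le> eps_p A \<and> norm (c x) \<le> eps_c A"

definition dpd_normal :: "(real^'d \<Rightarrow> real^'c) \<Rightarrow> real^'d \<Rightarrow> real^'d" where
  "dpd_normal c x = - (pinv (Jac c x) *v c x)"

text \<open>The flag tells which of the two admissible multipliers is chosen.\<close>

definition dpd_multiplier ::
    "(real^'d \<Rightarrow> real) \<Rightarrow> (real^'d \<Rightarrow> real^'c) \<Rightarrow> bool \<Rightarrow> real^'d \<Rightarrow> real^'c" where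
  "dpd_multiplier f c ls x = (if ls then - (transpose (pinv (Jac c x)) *v grad f x) else 0)"

definition dpd_hess ::
    "(real^'d \<Rightarrow> real) \<Rightarrow> (real^'d \<Rightarrow> real^'c) \<Rightarrow> bool \<Rightarrow> real^'d \<Rightarrow> real^'d^'d" where
  "dpd_hess f c ls x = hess (\<lambda>z. lagrangian f c z (dpd_multiplier f c ls x)) x"

definition dpd_tangential ::
    "('d, 'c) dpd_params \<Rightarrow> (real^'d \<Rightarrow> real) \<Rightarrow> (real^'d \<Rightarrow> real^'c) \<Rightarrow> bool \<Rightarrow> (real^'d) list \<Rightarrow>
      real^'d \<Rightarrow> (real^'d) option" where
  "dpd_tangential A f c ls Z x =
     projected_cr (dpd_hess f c ls x) (grad f x) Z (sigma A) (tau_tan A)"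

definition dpd_penalty ::
    "('d, 'c) dpd_params \<Rightarrow> (real^'d \<Rightarrow> real) \<Rightarrow> (real^'d \<Rightarrow> real^'c) \<Rightarrow> real^'d \<Rightarrow> real \<Rightarrow> real" where
  "dpd_penalty A f c x \<pi> =
     max (if c x \<noteq> 0 then (grad f x \<bullet> dpd_normal c x) / ((1 - rho A) * norm (c x)) else 0) \<pi>"

definition armijo ::
    "('d, 'c) dpd_params \<Rightarrow> (real^'d \<Rightarrow> real) \<Rightarrow> (real^'d \<Rightarrow> real^'c) \<Rightarrow> real^'d \<Rightarrow> real^'d \<Rightarrow> real \<Rightarrow>
      real \<Rightarrow> bool" where
  "armijo A f c x p \<pi> \<alpha> \<longleftrightarrow>
     merit f c (x + \<alpha> *\<^sub>R p) \<pi> \<le> merit f c x \<pi> + \<alpha> * eta A * Dbar f c x p \<pi>"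

definition backtracking ::
    "('d, 'c) dpd_params \<Rightarrow> (real^'d \<Rightarrow> real) \<Rightarrow> (real^'d \<Rightarrow> real^'c) \<Rightarrow> real^'d \<Rightarrow> real^'d \<Rightarrow> real \<Rightarrow>
      real option" where
  "backtracking A f c x p \<pi> =
     (if \<exists>j. armijo A f c x p \<pi> (theta A ^ j)
      then Some (theta A ^ (LEAST j. armijo A f c x p \<pi> (theta A ^ j))) else None)"

text \<open>\<open>dpd_state A f c ls Z k\<close> is \<open>Some (x\<^sub>k, \<lambda>\<^sub>k, \<pi>\<^sub>k\<^sub>-\<^sub>1)\<close>, or \<^const>\<open>None\<close> if the algorithm does not
  generate \<open>x\<^sub>k\<close>: it has stopped before, or an inner loop of an earlier iteration does not
  terminate. The run is determined by the choice \<open>ls k\<close> of the multiplier and the factor \<open>Z k\<close> of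
  the projection in iteration \<open>k\<close>.\<close>

primrec dpd_state ::
    "('d, 'c) dpd_params \<Rightarrow> (real^'d \<Rightarrow> real) \<Rightarrow> (real^'d \<Rightarrow> real^'c) \<Rightarrow> (nat \<Rightarrow> bool) \<Rightarrow>
      (nat \<Rightarrow> (real^'d) list) \<Rightarrow> nat \<Rightarrow> ((real^'d) \<times> (real^'c) \<times> real) option" where
  "dpd_state A f c ls Z 0 = Some (x_init A, lam_init A, pi_init A)"
| "dpd_state A f c ls Z (Suc k) =
    (case dpd_state A f c ls Z k of
       None \<Rightarrow> None
     | Some (x, l, \<pi>) \<Rightarrow>
         if dpd_stop A f c x then None
         else (case dpd_tangential A f c (ls k) (Z k) x of
             None \<Rightarrow> None
           | Some w \<Rightarrow>
               (let p = dpd_normal c x + w; \<pi>' = dpd_penalty A f c x \<pi>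
                in case backtracking A f c x p \<pi>' of
                     None \<Rightarrow> None
                   | Some \<alpha> \<Rightarrow> Some (x + \<alpha> *\<^sub>R p, dpd_multiplier f c (ls k) x, \<pi>'))))"

text \<open>The pairs \<open>(k, x\<^sub>k)\<close> for which iteration \<open>k\<close> gets past the stopping test.\<close>

definition dpd_active ::
    "('d, 'c) dpd_params \<Rightarrow> (real^'d \<Rightarrow> real) \<Rightarrow> (real^'d \<Rightarrow> real^'c) \<Rightarrow> (nat \<Rightarrow> bool) \<Rightarrow>
      (nat \<Rightarrow> (real^'d) list) \<Rightarrow> (nat \<times> (real^'d)) set" where
  "dpd_active A f c ls Z =
     {(k, x). \<exists>l \<pi>. dpd_state A f c ls Z k = Some (x, l, \<pi>) \<and> \<not> dpd_stop A f c x}"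

text \<open>The triples \<open>(x\<^sub>k, p\<^sub>k, \<pi>\<^sub>k)\<close> for which a line search is started, whether or not it
  terminates.\<close>

definition dpd_searches ::
    "('d, 'c) dpd_params \<Rightarrow> (real^'d \<Rightarrow> real) \<Rightarrow> (real^'d \<Rightarrow> real^'c) \<Rightarrow> (nat \<Rightarrow> bool) \<Rightarrow>
      (nat \<Rightarrow> (real^'d) list) \<Rightarrow> ((real^'d) \<times> (real^'d) \<times> real) set" where
  "dpd_searches A f c ls Z =
     {(x, dpd_normal c x + w, dpd_penalty A f c x \<pi>) | k x l \<pi> w.
        dpd_state A f c ls Z k = Some (x, l, \<pi>) \<and> \<not> dpd_stop A f c x \<and>
        dpd_tangential A f c (ls k) (Z k) x = Some w}"

definition iterates_and_trials ::
    "('d, 'c) dpd_params \<Rightarrow> (real^'d \<Rightarrow> real) \<Rightarrow> (real^'d \<Rightarrow> real^'c) \<Rightarrow> (nat \<Rightarrow> bool) \<Rightarrow>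
      (nat \<Rightarrow> (real^'d) list) \<Rightarrow> (real^'d) set" where
  "iterates_and_trials A f c ls Z =
     {x. \<exists>k l \<pi>. dpd_state A f c ls Z k = Some (x, l, \<pi>)} \<union>
     {x + theta A ^ j *\<^sub>R p | x p \<pi> j. (x, p, \<pi>) \<in> dpd_searches A f c ls Z \<and>
        (\<forall>i<j. \<not> armijo A f c x p \<pi> (theta A ^ i))}"

text \<open>Taylor estimates for a trial point need the Lipschitz conditions along the segment from the
  iterate; on the (discrete) set of iterates and trial points alone they do not restrict the
  function values.\<close>

definition search_segments ::
    "('d, 'c) dpd_params \<Rightarrow> (real^'d \<Rightarrow> real) \<Rightarrow> (real^'d \<Rightarrow> real^'c) \<Rightarrow> (nat \<Rightarrow> bool) \<Rightarrow>
      (nat \<Rightarrow> (real^'d) list) \<Rightarrow> (real^'d) set" where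
  "search_segments A f c ls Z =
     (\<Union>(x, p, \<pi>) \<in> dpd_searches A f c ls Z. closed_segment x (x + p))"

definition lagrangian_hess_bound ::
    "('d, 'c) dpd_params \<Rightarrow> (real^'d \<Rightarrow> real) \<Rightarrow> (real^'d \<Rightarrow> real^'c) \<Rightarrow> (nat \<Rightarrow> bool) \<Rightarrow>
      (nat \<Rightarrow> (real^'d) list) \<Rightarrow> real \<Rightarrow> bool" where
  "lagrangian_hess_bound A f c ls Z \<kappa>\<^sub>L \<longleftrightarrow>
     (\<forall>(k, x) \<in> dpd_active A f c ls Z. opnorm (dpd_hess f c (ls k) x) \<le> \<kappa>\<^sub>L)"


section \<open>The constants of the complexity bound\<close>

text \<open>A quotient \<open>a / 0\<close> with \<open>a > 0\<close> is read as \<open>\<infinity>\<close> in the minima below. It occurs in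
  \<open>\<omega>\<^sub>t\<^sub>a\<^sub>n\<close> if the Lagrangian Hessians vanish and in \<open>\<alpha>\<close> if both Lipschitz constants are \<open>0\<close>; the
  division of HOL, with \<open>a / 0 = 0\<close>, would make the constants \<open>0\<close> there.\<close>

definition gamma_tan :: "('d::finite, 'c::finite) dpd_params \<Rightarrow> real" where
  "gamma_tan A = min 1 (sigma A)"

definition omega_tan :: "('d::finite, 'c::finite) dpd_params \<Rightarrow> real \<Rightarrow> real" where
  "omega_tan A \<kappa>\<^sub>L =
     (let b = tau_tan A / sqrt ((tau_tan A)\<^sup>2 + \<kappa>\<^sub>L\<^sup>2)
      in if \<kappa>\<^sub>L = 0 then b else min (sigma A / \<kappa>\<^sub>L\<^sup>2) b)"

definition pi_bar :: "('d::finite, 'c::finite) dpd_params \<Rightarrow> real \<Rightarrow> real \<Rightarrow> real" where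
  "pi_bar A \<kappa>\<^sub>g \<sigma>\<^sub>J = max (\<kappa>\<^sub>g / ((1 - rho A) * \<sigma>\<^sub>J)) (pi_init A)"

definition alpha_bar ::
    "('d::finite, 'c::finite) dpd_params \<Rightarrow> real \<Rightarrow> real \<Rightarrow> real \<Rightarrow> real \<Rightarrow> real \<Rightarrow> real" where
  "alpha_bar A L\<^sub>f L\<^sub>c \<kappa>\<^sub>g \<kappa>\<^sub>c \<sigma>\<^sub>J =
     (let D = (pi_bar A \<kappa>\<^sub>g \<sigma>\<^sub>J * L\<^sub>c + L\<^sub>f) * max 1 (\<kappa>\<^sub>c / \<sigma>\<^sub>J\<^sup>2)
      in if D = 0 then 1
         else min 1 (theta A * (2 * (1 - eta A) * min (gamma_tan A) (pi_init A * rho A) / D)))"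

definition Gamma_c ::
    "('d::finite, 'c::finite) dpd_params \<Rightarrow> real \<Rightarrow> real \<Rightarrow> real \<Rightarrow> real \<Rightarrow> real \<Rightarrow> real" where
  "Gamma_c A L\<^sub>f L\<^sub>c \<kappa>\<^sub>g \<kappa>\<^sub>c \<sigma>\<^sub>J = alpha_bar A L\<^sub>f L\<^sub>c \<kappa>\<^sub>g \<kappa>\<^sub>c \<sigma>\<^sub>J * eta A * rho A"

definition Gamma_p ::
    "('d::finite, 'c::finite) dpd_params \<Rightarrow> real \<Rightarrow> real \<Rightarrow> real \<Rightarrow> real \<Rightarrow> real \<Rightarrow> real \<Rightarrow> real" where
  "Gamma_p A L\<^sub>f L\<^sub>c \<kappa>\<^sub>g \<kappa>\<^sub>c \<sigma>\<^sub>J \<kappa>\<^sub>L =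
     alpha_bar A L\<^sub>f L\<^sub>c \<kappa>\<^sub>g \<kappa>\<^sub>c \<sigma>\<^sub>J * eta A * gamma_tan A * (omega_tan A \<kappa>\<^sub>L)\<^sup>2 / pi_bar A \<kappa>\<^sub>g \<sigma>\<^sub>J"

end

theory Submission
  imports Defs
begin

text \<open>As long as the residuals of the conjugate residual method have positive curvature they are
  \<open>H\<close>-conjugate, hence linearly independent, so one of the tests succeeds within \<open>d\<close> steps. The
  conjugacy relations also give \<open>\<langle>g, w\<rangle> \<le> - \<gamma>\<^sub>t\<^sub>a\<^sub>n \<bar>w\<bar>\<^sup>2\<close> and \<open>\<bar>w\<bar> \<ge> \<omega>\<^sub>t\<^sub>a\<^sub>n \<bar>P g\<bar>\<close> for the
  returned step \<open>w\<close>, whichever test succeeds. Since \<open>J v = - c\<close> and \<open>J w = 0\<close>, the model decreases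
  by at least \<open>\<rho> \<pi> \<bar>c\<bar> + \<gamma>\<^sub>t\<^sub>a\<^sub>n \<bar>w\<bar>\<^sup>2\<close>, while \<open>\<bar>v + w\<bar>\<^sup>2\<close> is at most a multiple of
  \<open>\<bar>c\<bar> + \<bar>w\<bar>\<^sup>2\<close>; the Taylor estimates then bound the step size from below by \<^const>\<open>alpha_bar\<close>. As the
  penalty parameter is nondecreasing and at most \<^const>\<open>pi_bar\<close>, the potential
  \<open>(f - f\<^sub>l\<^sub>o\<^sub>w) / \<pi> + \<bar>c\<bar>\<close>, which is nonnegative, drops in every iteration by at least the
  denominator of \<open>K\<close>.\<close>

section \<open>Conjugate residuals of a self-adjoint operator\<close>

text \<open>The coordinate space of the conjugate residual method changes from iteration to
  iteration and may be trivial. Lifting its vectors by \<open>Z\<close> gives a run in R^d for the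
  operator \<open>P H P\<close>, so all estimates are proved for an abstract self-adjoint operator.
  The dimension d that bounds the number of steps is also what Cauchy-Schwarz costs in the curvature
  of \<open>d t\<close>; the factor d + 1 in the LPC test pays for it. The two terms of
  \<open>omega_tan\<close> belong to the two kinds of output:
  \<open>\<sigma> / \<kappa>\<^sup>2\<close> bounds the first step length from below and serves SOL,
  the other one comes from a failed SOL test and serves LPC. The merit function cannot measure
  progress over the whole run, because it grows with the penalty parameter. Subtracting the lower
  bound of \<open>f\<close> and dividing by the parameter leaves a quantity that an increase of the
  parameter can only lower. Two facts that are tacit on paper need proofs here: the Hessian is
  symmetric, and the entry of index \<open>CARD('m)\<close> in the list of singular values bounds
  \<open>norm (transpose J *v u)\<close> from below.\<close>

locale conjugate_residuals =
  fixes B :: "'a::euclidean_space \<Rightarrow> 'a" and d r y :: "nat \<Rightarrow> 'a" and \<zeta> \<beta> :: "nat \<Rightarrow> real"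
  assumes linear: "linear B"
    and self_adjoint: "B u \<bullet> v = u \<bullet> B v"
    and d_0: "d 0 = 0" and y_0: "y 0 = r 0"
    and \<zeta>_def: "\<zeta> t = (r t \<bullet> B (r t)) / (norm (B (y t)))\<^sup>2"
    and \<beta>_def: "\<beta> t = (r (Suc t) \<bullet> B (r (Suc t))) / (r t \<bullet> B (r t))"
    and d_Suc: "d (Suc t) = d t + \<zeta> t *\<^sub>R y t"
    and r_Suc: "r (Suc t) = r t - \<zeta> t *\<^sub>R B (y t)"
    and y_Suc: "y (Suc t) = r (Suc t) + \<beta> t *\<^sub>R y t"
begin

section \<open>Conjugacy relations\<close>

lemma linear_simps: "B (u + v) = B u + B v" "B (u - v) = B u - B v" "B (a *\<^sub>R u) = a *\<^sub>R B u" "B 0 = 0"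
  using linear by (simp_all add: linear_add linear_diff linear_scale linear_0)

text \<open>The inequality \<open>s < t\<close> is strict because a run that ends at
  \<open>t\<close> with an LPC test has no positive curvature at \<open>r t\<close> itself.\<close>

definition positive_before :: "nat \<Rightarrow> bool" where
  "positive_before t \<longleftrightarrow> (\<forall>s<t. 0 < r s \<bullet> B (r s))"

text \<open>The three relations are bundled because the induction step derives them from one
  another.\<close>

definition conjugate_upto :: "nat \<Rightarrow> bool" where
  "conjugate_upto t \<longleftrightarrow> (\<forall>j\<le>t. \<forall>i<j.
     B (y i) \<bullet> B (y j) = 0 \<and> r j \<bullet> B (y i) = 0 \<and> r j \<bullet> B (r i) = 0)"

text \<open>\<open>y i\<close> and \<open>r i\<close> differ by a multiple of the previous
  direction, whose image under \<open>B\<close> is orthogonal to \<open>r i\<close>. So the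
  numerator of \<open>\<zeta> i\<close> is also \<open>r i \<bullet> B (y i)\<close>, and the step
  minimises the residual norm along \<open>B (y i)\<close>.\<close>

lemma inner_r_y_eq:
  assumes "conjugate_upto t" "i \<le> t"
  shows "r i \<bullet> B (y i) = r i \<bullet> B (r i)"
proof (cases i)
  case (Suc n)
  then have "r i \<bullet> B (y n) = 0"
    using assms unfolding conjugate_upto_def by blast
  then show ?thesis using Suc by (simp add: y_Suc linear_simps inner_simps)
qed (simp add: y_0)

lemma By_pos:
  assumes "conjugate_upto t" "i \<le> t" "0 < r i \<bullet> B (r i)"
  shows "0 < (norm (B (y i)))\<^sup>2"
proof -
  have "B (y i) \<noteq> 0" using inner_r_y_eq[OF assms(1,2)] assms(3) by auto
  then show ?thesis by simp
qed

text \<open>\<open>\<zeta> t\<close> removes the component of the residual along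
  \<open>B (y t)\<close>, and \<open>\<beta> t\<close> makes the image of the new direction
  orthogonal to \<open>B (y t)\<close>. Smaller indices inherit orthogonality from the induction
  hypothesis.\<close>

lemma conjugate_upto_Suc:
  assumes conj: "conjugate_upto t" and pos: "positive_before (Suc t)"
  shows "conjugate_upto (Suc t)"
proof -
  note C = conj[unfolded conjugate_upto_def, rule_format]
  have \<zeta>_pos: "0 < \<zeta> i" and N: "0 < (norm (B (y i)))\<^sup>2" if "i \<le> t" for i
    using that pos By_pos[OF conj that] by (auto simp: \<zeta>_def positive_before_def)
  have rt: "0 < r t \<bullet> B (r t)" using pos by (simp add: positive_before_def)
  have \<zeta>N: "\<zeta> t * (norm (B (y t)))\<^sup>2 = r t \<bullet> B (r t)"
    using N[of t] by (simp add: \<zeta>_def)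
  have ry: "r (Suc t) \<bullet> B (y i) = 0" if "i \<le> t" for i
  proof (cases "i = t")
    case True
    then show ?thesis using inner_r_y_eq[OF conj, of t] \<zeta>N
      by (simp add: r_Suc inner_simps power2_norm_eq_inner)
  next
    case False
    then show ?thesis using C[of t i] that by (simp add: r_Suc inner_simps inner_commute)
  qed
  have rr: "r (Suc t) \<bullet> B (r i) = 0" if "i \<le> t" for i
  proof (cases i)
    case 0
    then show ?thesis using ry[of 0] by (simp add: y_0)
  next
    case (Suc n)
    then have "r i = y i - \<beta> n *\<^sub>R y n" by (simp add: y_Suc)
    then show ?thesis using ry[of i] ry[of n] Suc that by (simp add: linear_simps inner_simps)
  qed
  have rr': "r i \<bullet> B (r (Suc t)) = 0" if "i \<le> t" for i
    using rr[OF that] by (metis inner_commute self_adjoint)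
  \<comment> \<open>Solving the recurrence for \<open>B (y i)\<close>, possible as
    \<open>\<zeta> i > 0\<close>, turns conjugacy of residuals into orthogonality to
    \<open>B (y i)\<close>.\<close>
  have By: "B (y i) = (1 / \<zeta> i) *\<^sub>R (r i - r (Suc i))" if "i \<le> t" for i
    using \<zeta>_pos[OF that] by (simp add: r_Suc)
  have yy: "B (y i) \<bullet> B (y (Suc t)) = 0" if "i \<le> t" for i
  proof (cases "i = t")
    case True
    have "B (y t) \<bullet> B (r (Suc t)) = - (1 / \<zeta> t) * (r (Suc t) \<bullet> B (r (Suc t)))"
      using rr'[of t] by (subst By) (simp_all add: inner_simps)
    moreover have "\<beta> t * (norm (B (y t)))\<^sup>2 = (1 / \<zeta> t) * (r (Suc t) \<bullet> B (r (Suc t)))"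
      using rt N[of t] by (simp add: \<beta>_def \<zeta>_def)
    ultimately show ?thesis using True
      by (simp add: y_Suc linear_simps inner_simps power2_norm_eq_inner)
  next
    case False
    have "B (y i) \<bullet> B (r (Suc t)) = 0"
      using rr'[of i] rr'[of "Suc i"] False that by (subst By) (simp_all add: inner_simps)
    then show ?thesis using C[of t i] False that
      by (simp add: y_Suc linear_simps inner_simps)
  qed
  show ?thesis unfolding conjugate_upto_def
    using C ry rr yy by (metis le_Suc_eq less_Suc_eq_le)
qed

lemma positive_before_mono: "positive_before t \<Longrightarrow> s \<le> t \<Longrightarrow> positive_before s"
  by (auto simp: positive_before_def)

lemma conjugate: "positive_before t \<Longrightarrow> conjugate_upto t"
proof (induction t)
  case (Suc t)
  then show ?case using conjugate_upto_Suc positive_before_mono[of "Suc t" t] by simp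
qed (simp add: conjugate_upto_def)

section \<open>Consequences of positive curvature before a fixed step\<close>

context
  fixes t assumes pos: "positive_before t"
begin

lemma conjugateD:
  assumes "i < j" "j \<le> t"
  shows "r j \<bullet> B (y i) = 0" "r j \<bullet> B (r i) = 0"
  using conjugate[OF pos] assms by (auto simp: conjugate_upto_def)

lemma coefficients_pos:
  shows "s < t \<Longrightarrow> 0 < \<zeta> s" and "Suc s < t \<Longrightarrow> 0 < \<beta> s"
  using pos By_pos[OF conjugate[OF pos], of s] by (auto simp: \<zeta>_def \<beta>_def positive_before_def)

lemma residual_eq: "r 0 = r s + B (d s)"
  by (induction s) (simp_all add: r_Suc d_Suc d_0 linear_simps)

text \<open>Lowering \<open>i\<close> adds to \<open>r i\<close> a multiple of some
  \<open>B (y n)\<close> with \<open>n < j\<close>, which is orthogonal to \<open>r j\<close>; hence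
  the induction downwards from \<open>j\<close>. The case \<open>i = 0\<close> gives the descent of
  an LPC step.\<close>

lemma inner_residuals: "i \<le> j \<Longrightarrow> j \<le> t \<Longrightarrow> r j \<bullet> r i = (norm (r j))\<^sup>2"
proof (induction i rule: inc_induct)
  case (step n)
  then have "r n = r (Suc n) + \<zeta> n *\<^sub>R B (y n)" by (simp add: r_Suc)
  then show ?case using step conjugateD[of n j] by (simp add: inner_simps)
qed (simp add: power2_norm_eq_inner)

lemma inner_residuals_nonneg: "i \<le> t \<Longrightarrow> j \<le> t \<Longrightarrow> 0 \<le> r i \<bullet> r j"
  by (metis inner_residuals inner_commute zero_le_power2 nat_le_linear)

text \<open>Unrolled, \<open>y i\<close> is a combination of residuals weighted by products of
  \<open>\<beta>\<close>. The bound \<open>i < t\<close> is strict since \<open>\<beta> s\<close> is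
  known to be positive only for \<open>Suc s < t\<close>.\<close>

lemma inner_residual_y_nonneg: "i < t \<Longrightarrow> j \<le> t \<Longrightarrow> 0 \<le> r j \<bullet> y i"
proof (induction i)
  case (Suc i)
  then show ?case using inner_residuals_nonneg[of j "Suc i"] coefficients_pos(2)[of i]
    by (simp add: y_Suc inner_simps)
qed (simp add: y_0 inner_residuals_nonneg)

lemma inner_residual_d_nonneg: "s \<le> t \<Longrightarrow> j \<le> t \<Longrightarrow> 0 \<le> r j \<bullet> d s"
proof (induction s)
  case (Suc s)
  then show ?case using inner_residual_y_nonneg[of s j] coefficients_pos(1)[of s]
    by (simp add: d_Suc inner_simps)
qed (simp add: d_0)

lemma inner_residual_Bd: "r t \<bullet> B (d t) = 0"
proof -
  have "s \<le> t \<Longrightarrow> r t \<bullet> B (d s) = 0" for s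
    by (induction s) (simp_all add: d_0 d_Suc linear_simps inner_simps conjugateD)
  then show ?thesis by simp
qed

text \<open>Pythagoras for \<open>residual_eq\<close>. It turns a failed SOL test, which bounds
  \<open>B (d t)\<close> in terms of \<open>r t\<close>, into a lower bound for
  \<open>r t\<close>.\<close>

lemma norm_initial_residual: "(norm (r 0))\<^sup>2 = (norm (r t))\<^sup>2 + (norm (B (d t)))\<^sup>2"
  using inner_residual_Bd unfolding residual_eq[of t]
  by (simp add: power2_norm_eq_inner inner_simps inner_commute)

lemma residuals_B_orthogonal:
  assumes "i < t" "j < t" "i \<noteq> j" shows "r i \<bullet> B (r j) = 0"
proof -
  have "i < j \<Longrightarrow> r i \<bullet> B (r j) = 0"
    using conjugateD(2)[of i j] assms(2) by (metis inner_commute less_imp_le self_adjoint)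
  then show ?thesis
    using conjugateD(2)[of j i] assms by (meson less_imp_le linorder_neqE_nat)
qed

lemma steps_le_DIM: "t \<le> DIM('a)"
proof -
  have inj: "inj_on r {..<t}"
    using pos residuals_B_orthogonal unfolding inj_on_def positive_before_def
    by (metis lessThan_iff less_irrefl)
  have "independent (r ` {..<t})"
  proof (rule independent_if_scalars_zero)
    fix u v assume s: "(\<Sum>v\<in>r ` {..<t}. u v *\<^sub>R v) = 0" and "v \<in> r ` {..<t}"
    then obtain i where i: "i < t" "v = r i" by auto
    have "0 = (\<Sum>j<t. u (r j) *\<^sub>R r j) \<bullet> B (r i)"
      using s inj by (simp add: sum.reindex)
    also have "\<dots> = (\<Sum>j<t. if j = i then u (r i) * (r i \<bullet> B (r i)) else 0)"
      unfolding inner_sum_left using residuals_B_orthogonal i by (intro sum.cong) auto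
    also have "\<dots> = u (r i) * (r i \<bullet> B (r i))" using i by simp
    finally show "u v = 0" using pos i by (auto simp: positive_before_def)
  qed simp
  then have "card (r ` {..<t}) \<le> DIM('a)" using independent_bound by blast
  then show ?thesis by (simp add: card_image inj)
qed

lemma y_combination: "i < t \<Longrightarrow> \<exists>a. y i = (\<Sum>j\<le>i. a j *\<^sub>R r j)"
proof (induction i)
  case 0
  then show ?case by (intro exI[of _ "\<lambda>_. 1"]) (simp add: y_0)
next
  case (Suc i)
  then obtain a where "y i = (\<Sum>j\<le>i. a j *\<^sub>R r j)" by auto
  then show ?case
    by (intro exI[of _ "\<lambda>j. if j = Suc i then 1 else \<beta> i * a j"])
      (simp add: y_Suc scaleR_sum_right)
qed

lemma d_combination: "s \<le> t \<Longrightarrow> \<exists>a. d s = (\<Sum>j<s. a j *\<^sub>R r j)"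
proof (induction s)
  case 0
  then show ?case by (simp add: d_0)
next
  case (Suc s)
  then obtain a b where "d s = (\<Sum>j<s. a j *\<^sub>R r j)" "y s = (\<Sum>j\<le>s. b j *\<^sub>R r j)"
    using y_combination[of s] by auto
  then show ?case
    by (intro exI[of _ "\<lambda>j. (if j = s then 0 else a j) + \<zeta> s * b j"])
      (simp add: d_Suc scaleR_sum_right scaleR_left_distrib scaleR_right_distrib sum.distrib
        flip: lessThan_Suc_atMost)
qed

text \<open>In the \<open>B\<close>-orthogonal family of residuals \<open>\<langle>d, B d\<rangle>\<close> is a weighted sum of squares; passing
  to \<open>norm d\<close> by Cauchy-Schwarz costs the number of summands.\<close>

lemma curvature_d:
  assumes curv: "\<And>s. s < t \<Longrightarrow> real DIM('a) * \<sigma> * (norm (r s))\<^sup>2 \<le> r s \<bullet> B (r s)"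
    and "0 \<le> \<sigma>"
  shows "\<sigma> * (norm (d t))\<^sup>2 \<le> d t \<bullet> B (d t)"
proof -
  obtain a where a: "d t = (\<Sum>j<t. a j *\<^sub>R r j)" using d_combination by blast
  have "norm (d t) \<le> (\<Sum>j<t. norm (a j *\<^sub>R r j))" unfolding a by (rule norm_sum)
  then have "(norm (d t))\<^sup>2 \<le> (\<Sum>j<t. norm (a j *\<^sub>R r j))\<^sup>2" by (simp add: power_mono)
  also have "\<dots> \<le> real t * (\<Sum>j<t. (norm (a j *\<^sub>R r j))\<^sup>2)"
    using sum_squared_le_sum_of_squares[of "\<lambda>j. norm (a j *\<^sub>R r j)" "{..<t}"]
    by (simp add: mult.commute)
  also have "\<dots> \<le> real DIM('a) * (\<Sum>j<t. (norm (a j *\<^sub>R r j))\<^sup>2)"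
    using steps_le_DIM by (intro mult_right_mono sum_nonneg) auto
  finally have "\<sigma> * (norm (d t))\<^sup>2 \<le> \<sigma> * (real DIM('a) * (\<Sum>j<t. (norm (a j *\<^sub>R r j))\<^sup>2))"
    using \<open>0 \<le> \<sigma>\<close> by (rule mult_left_mono)
  also have "\<dots> = (\<Sum>j<t. (a j)\<^sup>2 * (real DIM('a) * \<sigma> * (norm (r j))\<^sup>2))"
    by (simp add: sum_distrib_left power_mult_distrib mult_ac)
  also have "\<dots> \<le> (\<Sum>j<t. (a j)\<^sup>2 * (r j \<bullet> B (r j)))"
    by (intro sum_mono mult_left_mono curv) auto
  also have "\<dots> = (\<Sum>j<t. \<Sum>i<t. if i = j then (a j)\<^sup>2 * (r j \<bullet> B (r j)) else 0)"
    by simp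
  also have "\<dots> = (\<Sum>j<t. \<Sum>i<t. (a j *\<^sub>R r j) \<bullet> (a i *\<^sub>R B (r i)))"
    using residuals_B_orthogonal by (intro sum.cong) (auto simp: power2_eq_square)
  also have "\<dots> = d t \<bullet> B (d t)"
    unfolding a
    by (subst sum.swap)
      (simp add: linear_sum[OF linear] linear_simps inner_sum_left inner_sum_right sum_distrib_left)
  finally show ?thesis .
qed

text \<open>\<open>r 0\<close> stands for the negative projected gradient.
  \<open>residual_eq\<close> splits off \<open>r t \<bullet> d t\<close>, which is nonnegative, and
  leaves the curvature of \<open>d t\<close>.\<close>

lemma descent_d:
  assumes curv: "\<And>s. s < t \<Longrightarrow> real DIM('a) * \<sigma> * (norm (r s))\<^sup>2 \<le> r s \<bullet> B (r s)"
    and "0 \<le> \<sigma>"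
  shows "\<sigma> * (norm (d t))\<^sup>2 \<le> r 0 \<bullet> d t"
proof -
  have "r 0 \<bullet> d t = r t \<bullet> d t + d t \<bullet> B (d t)"
    by (subst residual_eq[of t]) (simp add: inner_simps inner_commute)
  then show ?thesis using curvature_d[OF assms] inner_residual_d_nonneg[of t t] by simp
qed

text \<open>\<open>r 0 \<bullet> d s\<close> never decreases, as its increments are nonnegative
  multiples of \<open>r 0 \<bullet> y s\<close>, and after the first step it equals
  \<open>\<zeta> 0 * (norm (r 0))\<^sup>2\<close>. Cauchy-Schwarz passes to
  \<open>norm (d t)\<close>, and the two bounds at \<open>r 0\<close> give
  \<open>\<sigma> / \<kappa>\<^sup>2 \<le> \<zeta> 0\<close>.\<close>

lemma norm_d_ge:
  assumes "0 < t" and curv: "\<sigma> * (norm (r 0))\<^sup>2 \<le> r 0 \<bullet> B (r 0)"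
    and bnd: "norm (B (r 0)) \<le> \<kappa> * norm (r 0)" and "0 < \<kappa>" "0 \<le> \<sigma>"
  shows "\<sigma> / \<kappa>\<^sup>2 * norm (r 0) \<le> norm (d t)"
proof -
  have r0: "0 < norm (r 0)" "0 < norm (B (r 0))"
    using pos assms(1) by (auto simp: positive_before_def linear_simps)
  have "\<zeta> 0 * (norm (r 0))\<^sup>2 \<le> r 0 \<bullet> d s" if "0 < s" "s \<le> t" for s
    using that
  proof (induction s rule: nat_induct_non_zero)
    case 1
    show ?case by (simp add: d_Suc d_0 y_0 power2_norm_eq_inner)
  next
    case (Suc n)
    then show ?case using inner_residual_y_nonneg[of n 0] coefficients_pos(1)[of n]
      by (simp add: d_Suc inner_simps add_increasing2)
  qed
  from this[of t] have "\<zeta> 0 * (norm (r 0))\<^sup>2 \<le> norm (r 0) * norm (d t)"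
    using assms(1) norm_cauchy_schwarz[of "r 0" "d t"] by simp
  then have *: "\<zeta> 0 * norm (r 0) \<le> norm (d t)"
    using r0 by (simp add: power2_eq_square)
  have "\<sigma> / \<kappa>\<^sup>2 \<le> \<zeta> 0"
  proof -
    have "(norm (B (r 0)))\<^sup>2 \<le> (\<kappa> * norm (r 0))\<^sup>2" using bnd by (simp add: power_mono)
    then have "\<sigma> * (norm (B (r 0)))\<^sup>2 \<le> \<sigma> * (norm (r 0))\<^sup>2 * \<kappa>\<^sup>2"
      using \<open>0 \<le> \<sigma>\<close> by (simp add: power_mult_distrib mult_left_mono mult_ac)
    also have "\<dots> \<le> (r 0 \<bullet> B (r 0)) * \<kappa>\<^sup>2" using curv by (simp add: mult_right_mono)
    finally show ?thesis using r0 \<open>0 < \<kappa>\<close> by (simp add: \<zeta>_def y_0 field_simps)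
  qed
  then show ?thesis using * r0 by (meson mult_right_mono norm_ge_zero order_trans)
qed

end

end

section \<open>Projected conjugate residuals\<close>

lemma norm_matrix_vector_le_opnorm: "norm (M *v x) \<le> opnorm M * norm x"
  unfolding opnorm_def by (rule onorm[OF matrix_vector_mul_bounded_linear])

lemma opnorm_nonneg: "0 \<le> opnorm M"
  unfolding opnorm_def by (rule onorm_pos_le[OF matrix_vector_mul_bounded_linear])

lemma symmetric_idempotent_norm_le:
  fixes P :: "real^'n^'n"
  assumes "\<And>x y. (P *v x) \<bullet> y = x \<bullet> (P *v y)" "\<And>x. P *v (P *v x) = P *v x"
  shows "norm (P *v x) \<le> norm x"
proof -
  have "norm (P *v x) * norm (P *v x) = x \<bullet> (P *v x)"
    using assms by (simp add: dot_square_norm[symmetric] power2_eq_square[symmetric])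
  also have "\<dots> \<le> norm x * norm (P *v x)" by (rule norm_cauchy_schwarz)
  finally show ?thesis by (cases "P *v x = 0") (auto simp: mult_le_cancel_right)
qed

locale orthonormal_factor =
  fixes Z :: "(real^'d) list" and P :: "real^'d^'d"
  assumes factor: "is_orthonormal_factor Z P"
begin

lemma orthonormal: "i < length Z \<Longrightarrow> j < length Z \<Longrightarrow> Z ! i \<bullet> Z ! j = (if i = j then 1 else 0)"
  using factor by (simp add: is_orthonormal_factor_def)

lemma lift_restrict: "lift_vec Z (restrict_vec Z x) = P *v x"
proof -
  have P: "P = (\<chi> a b. \<Sum>i<length Z. (Z ! i) $ a * (Z ! i) $ b)"
    using factor by (simp add: is_orthonormal_factor_def)
  show ?thesis
    unfolding P lift_vec_def restrict_vec_def matrix_vector_mult_def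
    by (simp add: vec_eq_iff inner_vec_def sum_distrib_left sum_distrib_right mult_ac)
      (subst sum.swap, simp)
qed

lemma inner_nth_lift: "i < length Z \<Longrightarrow> Z ! i \<bullet> lift_vec Z u = u i"
  by (simp add: lift_vec_def inner_sum_right orthonormal if_distrib cong: if_cong)

lemma inner_lift: "lift_vec Z u \<bullet> x = (\<Sum>i<length Z. u i * (Z ! i \<bullet> x))"
  by (simp add: lift_vec_def inner_sum_left)

lemma ip_eq: "ip (length Z) u v = lift_vec Z u \<bullet> lift_vec Z v"
  by (simp add: ip_def inner_lift inner_nth_lift)

lemma nrm_eq: "nrm (length Z) u = norm (lift_vec Z u)"
  by (simp add: nrm_def ip_eq norm_eq_sqrt_inner)

lemma lift_cong: "(\<And>i. i < length Z \<Longrightarrow> u i = v i) \<Longrightarrow> lift_vec Z u = lift_vec Z v"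
  by (simp add: lift_vec_def)

lemma proj_lift: "P *v lift_vec Z u = lift_vec Z u"
  unfolding lift_restrict[symmetric]
  by (rule lift_cong) (simp add: restrict_vec_def inner_nth_lift)

lemma proj_idem: "P *v (P *v x) = P *v x"
  by (metis lift_restrict proj_lift)

lemma inner_lift_proj: "lift_vec Z u \<bullet> (P *v x) = lift_vec Z u \<bullet> x"
  unfolding inner_lift by (simp flip: lift_restrict add: inner_nth_lift restrict_vec_def)

lemma proj_self_adjoint: "(P *v x) \<bullet> y = x \<bullet> (P *v y)"
  by (metis inner_commute inner_lift_proj lift_restrict)

lemma norm_proj_le: "norm (P *v x) \<le> norm x"
  by (rule symmetric_idempotent_norm_le[OF proj_self_adjoint proj_idem])

text \<open>The rightmost \<open>P\<close> fixes the lifted vector; it is kept to make the operator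
  self-adjoint on all of R^d.\<close>

lemma lift_mv: "lift_vec Z (mv (length Z) (restrict_mat Z H) u) = P *v (H *v (P *v lift_vec Z u))"
proof -
  have "H *v lift_vec Z u = (\<Sum>j<length Z. u j *\<^sub>R (H *v (Z ! j)))"
    by (simp add: lift_vec_def linear_sum[OF matrix_vector_mul_linear]
        linear_scale[OF matrix_vector_mul_linear] matrix_vector_mult_scaleR)
  then show ?thesis
    unfolding proj_lift unfolding lift_restrict[symmetric]
    by (intro lift_cong)
      (simp add: mv_def restrict_mat_def restrict_vec_def inner_sum_right mult.commute)
qed

lemma lift_lincomb: "lift_vec Z (\<lambda>i. u i + a * v i) = lift_vec Z u + a *\<^sub>R lift_vec Z v"
  "lift_vec Z (\<lambda>i. u i - a * v i) = lift_vec Z u - a *\<^sub>R lift_vec Z v"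
  by (simp_all add: lift_vec_def scaleR_left_distrib scaleR_left_diff_distrib sum.distrib
      sum_subtractf scaleR_sum_right)

lemma projected_cr_properties:
  assumes sym: "\<And>u v. (H *v u) \<bullet> v = u \<bullet> (H *v v)"
    and "0 < \<sigma>" "0 < \<tau>" and \<kappa>: "opnorm H \<le> \<kappa>"
    and \<omega>: "\<omega> = (let b = \<tau> / sqrt (\<tau>\<^sup>2 + \<kappa>\<^sup>2) in if \<kappa> = 0 then b else min (\<sigma> / \<kappa>\<^sup>2) b)"
  obtains w where "projected_cr H g Z \<sigma> \<tau> = Some w" "P *v w = w"
    "g \<bullet> w \<le> - (min 1 \<sigma> * (norm w)\<^sup>2)" "\<omega> * norm (P *v g) \<le> norm w"
proof -
  define m A b where "m = length Z" and "A = restrict_mat Z H" and "b = restrict_vec Z g"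
  define it where "it t = cr_iter m A b t" for t
  define B where "B x = P *v (H *v (P *v x))" for x
  define d r y where "d t = lift_vec Z (fst (it t))" and "r t = lift_vec Z (fst (snd (it t)))"
    and "y t = lift_vec Z (snd (snd (it t)))" for t
  define \<zeta> \<beta> where "\<zeta> t = (r t \<bullet> B (r t)) / (norm (B (y t)))\<^sup>2"
    and "\<beta> t = (r (Suc t) \<bullet> B (r (Suc t))) / (r t \<bullet> B (r t))" for t
  have Lmv: "lift_vec Z (mv m A u) = B (lift_vec Z u)" for u
    by (simp add: m_def A_def B_def lift_mv)
  have ip: "ip m u v = lift_vec Z u \<bullet> lift_vec Z v" and nrm: "nrm m u = norm (lift_vec Z u)" for u v
    by (simp_all add: m_def ip_eq nrm_eq)
  \<comment> \<open>Lifting is linear and preserves inner products, so the lifted triple obeys the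
    same recurrences with the same scalars.\<close>
  have step: "d (Suc t) = d t + \<zeta> t *\<^sub>R y t \<and> r (Suc t) = r t - \<zeta> t *\<^sub>R B (y t) \<and>
      y (Suc t) = r (Suc t) + \<beta> t *\<^sub>R y t" for t
    by (cases "it t") (simp add: d_def r_def y_def \<zeta>_def \<beta>_def it_def Let_def Lmv ip nrm lift_lincomb
        del: times_divide_eq_left)
  have neg_b: "lift_vec Z (\<lambda>i. - b i) = - (P *v g)"
    by (simp add: lift_restrict[symmetric] b_def lift_vec_def sum_negf)
  interpret conjugate_residuals B d r y \<zeta> \<beta>
  proof (rule conjugate_residuals.intro)
    show "linear B" unfolding B_def
      by (intro linearI) (simp_all add: matrix_vector_right_distrib matrix_vector_mult_scaleR)
    show "B u \<bullet> v = u \<bullet> B v" for u v by (simp add: B_def proj_self_adjoint sym)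
  qed (use step in \<open>auto simp: d_def r_def y_def it_def \<zeta>_def \<beta>_def lift_vec_def\<close>)
  have r_0: "r 0 = - (P *v g)" by (simp add: r_def it_def neg_b)
  have P_fix: "P *v d t = d t" "P *v r t = r t" for t by (simp_all add: d_def r_def proj_lift)
  have "0 \<le> \<kappa>" using opnorm_nonneg[of H] \<kappa> by simp
  have B_le: "norm (B x) \<le> \<kappa> * norm x" for x
  proof -
    have "norm (B x) \<le> opnorm H * norm (P *v x)" unfolding B_def
      by (rule order_trans[OF norm_proj_le norm_matrix_vector_le_opnorm])
    also have "\<dots> \<le> \<kappa> * norm x" using \<kappa> norm_proj_le[of x] \<open>0 \<le> \<kappa>\<close> opnorm_nonneg[of H]
      by (intro mult_mono) auto
    finally show ?thesis .
  qed
  define lpc where "lpc t \<longleftrightarrow> r t \<bullet> B (r t) \<le> (real CARD('d) + 1) * \<sigma> * (norm (r t))\<^sup>2" for t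
  define sol where "sol t \<longleftrightarrow> norm (B (r t)) \<le> \<tau> * norm (B (d t))" for t
  define halt where "halt t \<longleftrightarrow> 1 \<le> t \<and> (sol t \<or> lpc t)" for t
  have cr: "projected_cr H g Z \<sigma> \<tau> =
      (if lpc 0 then Some (r 0) else if \<exists>t. halt t
       then (let t = LEAST t. halt t in Some (if sol t then d t else r t)) else None)"
    unfolding projected_cr_def halt_def lpc_def sol_def Let_def
      m_def[symmetric] A_def[symmetric] b_def[symmetric] it_def[symmetric]
      ip nrm Lmv r_def[symmetric] d_def[symmetric] by (rule refl)
  have pos: "positive_before t" if "\<And>s. s < t \<Longrightarrow> \<not> lpc s" for t
    unfolding positive_before_def
  proof (intro allI impI)
    fix s assume "s < t"
    then have "(real CARD('d) + 1) * \<sigma> * (norm (r s))\<^sup>2 < r s \<bullet> B (r s)"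
      using that[of s] by (simp add: lpc_def)
    moreover have "0 \<le> (real CARD('d) + 1) * \<sigma> * (norm (r s))\<^sup>2" using \<open>0 < \<sigma>\<close> by simp
    ultimately show "0 < r s \<bullet> B (r s)" by linarith
  qed
  define q where "q = \<tau> / sqrt (\<tau>\<^sup>2 + \<kappa>\<^sup>2)"
  have q: "0 < q" "q \<le> 1" "\<omega> \<le> q" "\<kappa> \<noteq> 0 \<Longrightarrow> \<omega> \<le> \<sigma> / \<kappa>\<^sup>2"
  proof -
    have "0 < sqrt (\<tau>\<^sup>2 + \<kappa>\<^sup>2)" "\<tau> \<le> sqrt (\<tau>\<^sup>2 + \<kappa>\<^sup>2)"
      using \<open>0 < \<tau>\<close> by (auto simp: add_pos_nonneg intro: real_le_rsqrt)
    then show "0 < q" "q \<le> 1" using \<open>0 < \<tau>\<close> by (simp_all add: q_def)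
  qed (simp_all add: \<omega> q_def Let_def)
  have gw: "g \<bullet> w = - (r 0 \<bullet> w)" if "P *v w = w" for w
    using that proj_self_adjoint[of g w] by (simp add: r_0)
  show thesis
  proof (cases "lpc 0")
    \<comment> \<open>On immediate exit the step is the whole negative projected gradient, so its
      size asks only for \<open>\<omega> \<le> q \<le> 1\<close>.\<close>
    case True
    show thesis
    proof
      show "projected_cr H g Z \<sigma> \<tau> = Some (r 0)" using True cr by simp
      show "g \<bullet> r 0 \<le> - (min 1 \<sigma> * (norm (r 0))\<^sup>2)"
        using mult_right_mono[of "min 1 \<sigma>" 1 "(norm (r 0))\<^sup>2"]
        by (simp add: gw[OF P_fix(2)] power2_norm_eq_inner)
      show "\<omega> * norm (P *v g) \<le> norm (r 0)"
        using q mult_right_mono[of \<omega> 1 "norm (P *v g)"] by (simp add: r_0)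
    qed (rule P_fix)
  next
    case not0: False
    have ex: "\<exists>t. halt t"
    proof (rule ccontr)
      assume "\<nexists>t. halt t"
      then have "\<not> lpc t" for t using not0 by (cases t) (auto simp: halt_def)
      then have "Suc DIM(real^'d) \<le> DIM(real^'d)" by (intro steps_le_DIM pos)
      then show False by simp
    qed
    define t where "t = (LEAST t. halt t)"
    have "halt t" using ex unfolding t_def by (rule LeastI_ex)
    \<comment> \<open>For \<open>s \<ge> 1\<close> a successful LPC test would already be a halt
      before \<open>t\<close>; \<open>s = 0\<close> is excluded by the initial test.\<close>
    have not_lpc: "\<not> lpc s" if "s < t" for s
      using that not0 not_less_Least[of s halt] by (cases s) (auto simp: halt_def t_def)
    note pos_t = pos[OF not_lpc, of t]
    have res: "projected_cr H g Z \<sigma> \<tau> = Some (if sol t then d t else r t)"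
      using cr not0 ex by (simp add: t_def Let_def)
    \<comment> \<open>One threshold serves twice: the share d of the factor d + 1 is what
      \<open>curvature_d\<close> consumes, the share 1 is what \<open>norm_d_ge\<close> asks
      for.\<close>
    have curv: "real DIM(real^'d) * \<sigma> * (norm (r s))\<^sup>2 \<le> r s \<bullet> B (r s)"
      "\<sigma> * (norm (r s))\<^sup>2 \<le> r s \<bullet> B (r s)" if "s < t" for s
    proof -
      have "(real CARD('d) + 1) * \<sigma> * (norm (r s))\<^sup>2 \<le> r s \<bullet> B (r s)"
        using not_lpc[OF that] by (simp add: lpc_def)
      moreover have "0 \<le> \<sigma> * (norm (r s))\<^sup>2" "0 \<le> real CARD('d) * \<sigma> * (norm (r s))\<^sup>2"
        using \<open>0 < \<sigma>\<close> by simp_all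
      ultimately show "real DIM(real^'d) * \<sigma> * (norm (r s))\<^sup>2 \<le> r s \<bullet> B (r s)"
        "\<sigma> * (norm (r s))\<^sup>2 \<le> r s \<bullet> B (r s)" by (simp_all add: algebra_simps)
    qed
    have "0 < t" using \<open>halt t\<close> by (simp add: halt_def)
    \<comment> \<open>With \<open>\<kappa> = 0\<close> the operator vanishes and the initial LPC
      test succeeds, so here \<open>\<omega>\<close> is the genuine minimum of two terms.\<close>
    have "\<kappa> \<noteq> 0"
    proof
      assume "\<kappa> = 0"
      then have "B (r 0) = 0" using B_le[of "r 0"] by simp
      then show False using not0 \<open>0 < \<sigma>\<close> by (simp add: lpc_def)
    qed
    show thesis
    proof (cases "sol t")
      case True
      show thesis
      proof
        show "projected_cr H g Z \<sigma> \<tau> = Some (d t)" using True res by simp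
        have "\<sigma> * (norm (d t))\<^sup>2 \<le> r 0 \<bullet> d t"
          using descent_d[OF pos_t curv(1)] \<open>0 < \<sigma>\<close> by simp
        moreover have "min 1 \<sigma> * (norm (d t))\<^sup>2 \<le> \<sigma> * (norm (d t))\<^sup>2"
          by (intro mult_right_mono) auto
        ultimately show "g \<bullet> d t \<le> - (min 1 \<sigma> * (norm (d t))\<^sup>2)"
          by (simp add: gw[OF P_fix(1)])
        have "\<sigma> / \<kappa>\<^sup>2 * norm (r 0) \<le> norm (d t)"
          using norm_d_ge[OF pos_t \<open>0 < t\<close> curv(2)[OF \<open>0 < t\<close>] B_le] \<open>0 \<le> \<kappa>\<close> \<open>\<kappa> \<noteq> 0\<close> \<open>0 < \<sigma>\<close>
          by simp
        moreover have "\<omega> * norm (P *v g) \<le> \<sigma> / \<kappa>\<^sup>2 * norm (r 0)"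
          using mult_right_mono[OF q(4)[OF \<open>\<kappa> \<noteq> 0\<close>]] by (simp add: r_0 del: times_divide_eq_left)
        ultimately show "\<omega> * norm (P *v g) \<le> norm (d t)" by linarith
      qed (rule P_fix)
    next
      case False
      show thesis
      proof
        show "projected_cr H g Z \<sigma> \<tau> = Some (r t)" using False res by simp
        have "r 0 \<bullet> r t = (norm (r t))\<^sup>2"
          using inner_residuals[OF pos_t, of 0 t] by (simp add: inner_commute)
        moreover have "min 1 \<sigma> * (norm (r t))\<^sup>2 \<le> 1 * (norm (r t))\<^sup>2"
          by (intro mult_right_mono) auto
        ultimately show "g \<bullet> r t \<le> - (min 1 \<sigma> * (norm (r t))\<^sup>2)"
          by (simp add: gw[OF P_fix(2)])
        \<comment> \<open>The failed SOL test and the norm bound for \<open>B\<close>; eliminating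
          \<open>B (d t)\<close> by Pythagoras produces the constant \<open>q\<close>.\<close>
        have "\<tau> * norm (B (d t)) \<le> \<kappa> * norm (r t)"
          using False B_le[of "r t"] by (simp add: sol_def)
        then have "(\<tau> * norm (B (d t)))\<^sup>2 \<le> (\<kappa> * norm (r t))\<^sup>2"
          using \<open>0 < \<tau>\<close> by (intro power_mono) auto
        then have "\<tau>\<^sup>2 * (norm (r 0))\<^sup>2 \<le> (\<tau>\<^sup>2 + \<kappa>\<^sup>2) * (norm (r t))\<^sup>2"
          using norm_initial_residual[OF pos_t] by (simp add: power_mult_distrib algebra_simps)
        then have "sqrt (\<tau>\<^sup>2 * (norm (r 0))\<^sup>2) \<le> sqrt ((\<tau>\<^sup>2 + \<kappa>\<^sup>2) * (norm (r t))\<^sup>2)"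
          by (rule real_sqrt_le_mono)
        then have "\<tau> * norm (r 0) \<le> sqrt (\<tau>\<^sup>2 + \<kappa>\<^sup>2) * norm (r t)"
          using \<open>0 < \<tau>\<close> by (simp add: real_sqrt_mult)
        moreover have "0 < sqrt (\<tau>\<^sup>2 + \<kappa>\<^sup>2)" using \<open>0 < \<tau>\<close> by (simp add: add_pos_nonneg)
        ultimately have "q * norm (r 0) \<le> norm (r t)" by (simp add: q_def field_simps)
        moreover have "\<omega> * norm (P *v g) \<le> q * norm (r 0)"
          using q(3) by (simp add: r_0 mult_right_mono)
        ultimately show "\<omega> * norm (P *v g) \<le> norm (r t)" by linarith
      qed (rule P_fix)
    qed
  qed
qed

end

section \<open>Smallest singular value and pseudoinverse\<close>

lemma inner_matrix_transpose: "(M *v x) \<bullet> y = x \<bullet> (transpose M *v y)"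
  for M :: "real^'n^'m"
  by (metis dot_lmul_matrix inner_commute transpose_matrix_vector)

text \<open>Orthogonal bases of the subspaces are disjoint and unite to an independent set. This
  limits the number of eigenvalues counted with multiplicity.\<close>

lemma sum_dim_orthogonal_subspaces_le:
  fixes S :: "'i \<Rightarrow> ('a::euclidean_space) set"
  assumes "finite I" and sub: "\<And>i. i \<in> I \<Longrightarrow> subspace (S i)"
    and orth: "\<And>i j u v. i \<in> I \<Longrightarrow> j \<in> I \<Longrightarrow> i \<noteq> j \<Longrightarrow> u \<in> S i \<Longrightarrow> v \<in> S j \<Longrightarrow> u \<bullet> v = 0"
  shows "(\<Sum>i\<in>I. dim (S i)) \<le> DIM('a)"
proof -
  have "\<exists>B. 0 \<notin> B \<and> B \<subseteq> S i \<and> pairwise orthogonal B \<and> card B = dim (S i)" if "i \<in> I" for i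
    using orthogonal_basis_subspace[OF sub[OF that]] by metis
  then obtain B where B: "\<And>i. i \<in> I \<Longrightarrow> 0 \<notin> B i \<and> B i \<subseteq> S i \<and> pairwise orthogonal (B i)"
    and card: "\<And>i. i \<in> I \<Longrightarrow> card (B i) = dim (S i)" by metis
  have fin: "finite (B i)" if "i \<in> I" for i
    using B[OF that] pairwise_orthogonal_imp_finite by auto
  have disj: "B i \<inter> B j = {}" if ij: "i \<in> I" "j \<in> I" "i \<noteq> j" for i j
  proof (rule ccontr)
    assume "B i \<inter> B j \<noteq> {}"
    then obtain b where b: "b \<in> B i" "b \<in> B j" by blast
    then have "b \<bullet> b = 0" using orth[OF ij] B ij by blast
    then show False using b B ij by simp
  qed
  have "pairwise orthogonal (\<Union>i\<in>I. B i)"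
  proof (rule pairwiseI)
    fix u v assume "u \<in> (\<Union>i\<in>I. B i)" "v \<in> (\<Union>i\<in>I. B i)" "u \<noteq> v"
    then obtain i j where ij: "i \<in> I" "j \<in> I" "u \<in> B i" "v \<in> B j" by blast
    show "orthogonal u v"
    proof (cases "i = j")
      case True
      then show ?thesis using B[OF ij(1)] ij \<open>u \<noteq> v\<close> by (auto simp: pairwise_def)
    next
      case False
      then show ?thesis using B ij orth[of i j u v] by (auto simp: orthogonal_def)
    qed
  qed
  moreover have "0 \<notin> (\<Union>i\<in>I. B i)" using B by blast
  ultimately have "independent (\<Union>i\<in>I. B i)" by (rule pairwise_orthogonal_independent)
  then have "card (\<Union>i\<in>I. B i) \<le> DIM('a)" using independent_bound by blast
  moreover have "card (\<Union>i\<in>I. B i) = (\<Sum>i\<in>I. card (B i))"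
    using \<open>finite I\<close> fin disj by (intro card_UN_disjoint) auto
  ultimately show ?thesis using card by simp
qed

lemma subspace_eigenspace: "subspace (eigenspace M \<mu>)"
  unfolding eigenspace_def subspace_def
  by (simp add: matrix_vector_right_distrib matrix_vector_mult_scaleR scaleR_right_distrib
      scaleR_left_commute)

lemma orthogonal_eigenspaces:
  fixes M :: "real^'n^'n"
  assumes sym: "\<And>u v. (M *v u) \<bullet> v = u \<bullet> (M *v v)"
    and "\<mu> \<noteq> \<nu>" "u \<in> eigenspace M \<mu>" "v \<in> eigenspace M \<nu>"
  shows "u \<bullet> v = 0"
  using sym[of u v] assms(2-) by (simp add: eigenspace_def)

lemma size_sum_multiset: "size (sum f S :: 'a multiset) = (\<Sum>x\<in>S. size (f x))"
  by (induction S rule: infinite_finite_induct) auto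

lemma gram_self_adjoint: "((J ** transpose J) *v u) \<bullet> v = u \<bullet> ((J ** transpose J) *v v)"
  for J :: "real^'n^'m"
  by (simp add: inner_matrix_transpose matrix_transpose_mul)

text \<open>If the singular value with index \<open>CARD('m)\<close> is nonzero, then the list is long enough; as
  eigenspaces are orthogonal, it is not longer, so that this is the last and smallest entry.\<close>

lemma singular_value_le_sqrt_eigenvalue:
  fixes J :: "real^'n^'m"
  assumes pos: "0 < singular_value J CARD('m)" and ev: "eigenspace (J ** transpose J) \<mu> \<noteq> {0}"
  shows "singular_value J CARD('m) \<le> sqrt \<mu>"
proof -
  define M where "M = J ** transpose J"
  define E where "E = {\<mu>. eigenspace M \<mu> \<noteq> {0}}"
  define S where "S = image_mset sqrt (\<Sum>\<mu>\<in>E. replicate_mset (dim (eigenspace M \<mu>)) \<mu>)"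
  define xs where "xs = sorted_list_of_multiset S"
  have sv: "singular_values J = rev xs"
    by (simp add: singular_values_def Let_def xs_def S_def E_def M_def)
  have len_ge: "CARD('m) \<le> length xs" and val: "singular_value J CARD('m) = rev xs ! (CARD('m) - 1)"
    using pos by (auto simp: singular_value_def sv split: if_splits)
  have "finite E"
  proof (rule ccontr)
    \<comment> \<open>A sum over an infinite set has the default value 0, which would make the list
      empty.\<close>
    assume "infinite E"
    then have "xs = []" by (simp add: xs_def S_def)
    then show False using len_ge by simp
  qed
  have "length xs = size S" by (metis mset_sorted_list_of_multiset size_mset xs_def)
  also have "\<dots> = (\<Sum>\<mu>\<in>E. dim (eigenspace M \<mu>))" by (simp add: S_def size_sum_multiset)
  also have "\<dots> \<le> DIM(real^'m)"
    using orthogonal_eigenspaces[of M] gram_self_adjoint[of J] subspace_eigenspace[of M]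
    by (intro sum_dim_orthogonal_subspaces_le \<open>finite E\<close>) (auto simp: M_def)
  finally have len: "length xs = CARD('m)" using len_ge by simp
  have "\<mu> \<in> E" using ev by (simp add: E_def M_def)
  have "eigenspace M \<mu> \<noteq> {0}" using ev by (simp add: M_def)
  moreover have "0 \<in> eigenspace M \<mu>" using subspace_eigenspace subspace_0 by blast
  ultimately have "dim (eigenspace M \<mu>) \<noteq> 0" by auto
  then have "\<mu> \<in># replicate_mset (dim (eigenspace M \<mu>)) \<mu>" by simp
  then have "sqrt \<mu> \<in># S"
    using \<open>\<mu> \<in> E\<close> \<open>finite E\<close> by (auto simp: S_def set_mset_sum)
  then have "sqrt \<mu> \<in> set xs" by (simp add: xs_def)
  then obtain i where "i < length xs" "xs ! i = sqrt \<mu>" by (auto simp: in_set_conv_nth)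
  moreover have "sorted xs" by (simp add: xs_def)
  \<comment> \<open>\<open>xs\<close> is increasing with exactly \<open>CARD('m)\<close> entries, so
    the last entry of \<open>rev xs\<close> is the head of \<open>xs\<close>.\<close>
  ultimately have "xs ! 0 \<le> sqrt \<mu>" by (metis sorted_nth_mono zero_le)
  then show ?thesis using len val by (simp add: rev_nth)
qed

text \<open>The quadratic form attains its minimum on the compact unit sphere, and a minimiser is an
  eigenvector for the minimal value.\<close>

lemma rayleigh_minimum:
  fixes M :: "real^'n^'n"
  assumes sym: "\<And>u v. (M *v u) \<bullet> v = u \<bullet> (M *v v)"
  obtains \<mu> where "eigenspace M \<mu> \<noteq> {0}" "\<And>x. \<mu> * (norm x)\<^sup>2 \<le> x \<bullet> (M *v x)"
proof -
  have "continuous_on (sphere 0 1) (\<lambda>x. x \<bullet> (M *v x))"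
    by (intro continuous_intros linear_continuous_on matrix_vector_mul_bounded_linear)
  moreover have "sphere (0 :: real^'n) 1 \<noteq> {}" by simp
  ultimately obtain u where u: "norm u = 1"
    and min: "\<And>x. norm x = 1 \<Longrightarrow> u \<bullet> (M *v u) \<le> x \<bullet> (M *v x)"
    using continuous_attains_inf[of "sphere 0 1" "\<lambda>x. x \<bullet> (M *v x)"] by auto
  define \<mu> where "\<mu> = u \<bullet> (M *v u)"
  have ge: "\<mu> * (norm x)\<^sup>2 \<le> x \<bullet> (M *v x)" for x
  proof (cases "x = 0")
    case False
    then have "\<mu> \<le> (1 / norm x * (1 / norm x)) * (x \<bullet> (M *v x))"
      using min[of "(1 / norm x) *\<^sub>R x"] by (simp add: \<mu>_def matrix_vector_mult_scaleR)
    then show ?thesis using False by (simp add: field_simps power2_eq_square)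
  qed simp
  define z where "z = M *v u - \<mu> *\<^sub>R u"
  have "z = 0"
  proof (rule ccontr)
    assume "z \<noteq> 0"
    text \<open>The quadratic form \<open>q x = x \<bullet> M x - \<mu> \<bar>x\<bar>\<^sup>2\<close> is nonnegative and vanishes at \<open>u\<close>, so its
      derivative \<open>2 z\<close> there is \<open>0\<close>.\<close>
    define q where "q = z \<bullet> (M *v z) - \<mu> * (norm z)\<^sup>2"
    have exp: "0 \<le> 2 * t * (norm z)\<^sup>2 + t * t * q" for t
    proof -
      have "(M *v z) \<bullet> u = z \<bullet> (M *v u)" by (rule sym)
      then have "(u + t *\<^sub>R z) \<bullet> (M *v (u + t *\<^sub>R z)) - \<mu> * (norm (u + t *\<^sub>R z))\<^sup>2 =
          (u \<bullet> (M *v u) - \<mu> * (norm u)\<^sup>2) + 2 * t * (z \<bullet> (M *v u - \<mu> *\<^sub>R u)) + t * t * q"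
        by (simp add: q_def matrix_vector_right_distrib matrix_vector_mult_scaleR inner_simps
            power2_norm_eq_inner inner_commute algebra_simps)
      moreover have "u \<bullet> (M *v u) - \<mu> * (norm u)\<^sup>2 = 0" using u by (simp add: \<mu>_def)
      ultimately show ?thesis
        using ge[of "u + t *\<^sub>R z"] unfolding z_def[symmetric]
        by (simp only: power2_norm_eq_inner[of z])
    qed
    \<comment> \<open>Chosen so that at \<open>t = - s\<close> the linear term outweighs the
      quadratic one; the \<open>+ 1\<close> covers \<open>q = 0\<close>.\<close>
    define s where "s = (norm z)\<^sup>2 / (\<bar>q\<bar> + 1)"
    have "0 < s" using \<open>z \<noteq> 0\<close> by (simp add: s_def add_nonneg_pos)
    have "s * \<bar>q\<bar> < 2 * (norm z)\<^sup>2"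
    proof -
      have "s * (\<bar>q\<bar> + 1) = (norm z)\<^sup>2" by (simp add: s_def)
      then show ?thesis using \<open>0 < s\<close> zero_le_power2[of "norm z"] unfolding distrib_left by linarith
    qed
    moreover have "0 \<le> s * (s * q - 2 * (norm z)\<^sup>2)"
      using exp[of "- s"] by (simp add: algebra_simps)
    then have "2 * (norm z)\<^sup>2 \<le> s * q" using \<open>0 < s\<close> by (simp add: zero_le_mult_iff)
    moreover have "s * q \<le> s * \<bar>q\<bar>" using \<open>0 < s\<close> by simp
    ultimately show False by linarith
  qed
  then have "u \<in> eigenspace M \<mu>" by (simp add: z_def eigenspace_def)
  then have "eigenspace M \<mu> \<noteq> {0}" using u by (metis norm_zero singletonD zero_neq_one)
  then show thesis using that ge by blast
qed

text \<open>The least Rayleigh quotient of the Gram matrix is an eigenvalue, so its root is at least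
  the smallest singular value. This turns the hypothesis on singular values into an inequality about
  vectors.\<close>

lemma norm_transpose_ge_singular_value:
  fixes J :: "real^'n^'m"
  assumes "0 < s" "s \<le> singular_value J CARD('m)"
  shows "s * norm u \<le> norm (transpose J *v u)"
proof -
  define M where "M = J ** transpose J"
  obtain \<mu> where \<mu>: "eigenspace M \<mu> \<noteq> {0}" "\<And>x. \<mu> * (norm x)\<^sup>2 \<le> x \<bullet> (M *v x)"
    using rayleigh_minimum[of M] gram_self_adjoint[of J] unfolding M_def by metis
  have "s \<le> sqrt \<mu>"
    using singular_value_le_sqrt_eigenvalue[of J \<mu>] \<mu>(1) assms by (simp add: M_def)
  then have "s\<^sup>2 \<le> \<mu>"
    using assms(1) by (metis less_le_trans order_less_imp_le power_mono real_sqrt_gt_0_iff real_sqrt_pow2)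
  then have "(s * norm u)\<^sup>2 \<le> \<mu> * (norm u)\<^sup>2" by (simp add: power_mult_distrib mult_right_mono)
  also have "\<dots> \<le> u \<bullet> (M *v u)" by (rule \<mu>(2))
  also have "\<dots> = (norm (transpose J *v u))\<^sup>2"
    by (simp add: M_def matrix_vector_mul_assoc[symmetric] power2_norm_eq_inner
        dot_lmul_matrix)
  finally show ?thesis by (simp add: power2_le_iff_abs_le assms(1) less_imp_le)
qed

text \<open>Uniqueness for the Penrose equations, on which the definite description in
  \<open>pinv\<close> depends. \<open>M ** B\<close> and \<open>M ** C\<close> are both the
  orthogonal projection onto the range of \<open>M\<close>, and the reversed products agree
  likewise.\<close>

lemma pinv_eqI:
  fixes M :: "real^'n^'m"
  assumes "M ** B ** M = M" "B ** M ** B = B"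
    "transpose (M ** B) = M ** B" "transpose (B ** M) = B ** M"
  shows "pinv M = B"
  unfolding pinv_def
proof (rule the_equality)
  fix C assume C: "M ** C ** M = M \<and> C ** M ** C = C \<and>
    transpose (M ** C) = M ** C \<and> transpose (C ** M) = C ** M"
  have "M ** C = transpose (M ** C)" using C by simp
  also have "\<dots> = transpose ((M ** B) ** (M ** C))"
    using assms(1) by (simp add: matrix_mul_assoc)
  also have "\<dots> = (M ** C) ** (M ** B)" using C assms(3) by (simp only: matrix_transpose_mul)
  also have "\<dots> = M ** B" using C by (simp add: matrix_mul_assoc)
  finally have MC: "M ** C = M ** B" .
  have "C ** M = transpose (C ** M)" using C by simp
  also have "\<dots> = transpose ((C ** M) ** (B ** M))"
    using assms(1) by (simp add: matrix_mul_assoc[symmetric])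
  also have "\<dots> = (B ** M) ** (C ** M)" using C assms(4) by (simp only: matrix_transpose_mul)
  also have "\<dots> = B ** M" using C by (simp add: matrix_mul_assoc[symmetric])
  finally have CM: "C ** M = B ** M" .
  have "C = C ** M ** C" using C by simp
  also have "\<dots> = B ** (M ** C)" by (simp add: CM matrix_mul_assoc)
  also have "\<dots> = B" using assms(2) by (simp add: MC matrix_mul_assoc)
  finally show "C = B" .
qed (use assms in simp)

text \<open>A positive bound excludes the default 0 that \<open>singular_value\<close> takes beyond
  the end of the list, so the rank is \<open>CARD('m)\<close>.\<close>

locale full_row_rank =
  fixes J :: "real^'n^'m" and s :: real
  assumes s_pos: "0 < s" and s_le: "s \<le> singular_value J CARD('m)"
begin

lemma pinv_eq: "pinv J = transpose J ** matrix_inv (J ** transpose J)"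
  and mult_pinv: "J ** pinv J = mat 1"
proof -
  define M where "M = J ** transpose J"
  have "x = 0" if "M *v x = 0" for x
  proof -
    have "(norm (transpose J *v x))\<^sup>2 = x \<bullet> (M *v x)"
      by (simp add: M_def matrix_vector_mul_assoc[symmetric] power2_norm_eq_inner
          dot_lmul_matrix)
    then have "s * norm x \<le> 0"
      using norm_transpose_ge_singular_value[OF s_pos s_le, of x] that by simp
    then show ?thesis using s_pos by (simp add: mult_le_0_iff)
  qed
  then have "invertible M"
    using matrix_left_invertible_ker[of M] invertible_left_inverse[of M] by blast
  then have inv: "M ** matrix_inv M = mat 1" "matrix_inv M ** M = mat 1"
    using someI_ex[OF \<open>invertible M\<close>[unfolded invertible_def]] unfolding matrix_inv_def by blast+
  have "transpose M = M" by (simp add: M_def matrix_transpose_mul)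
  have "transpose (matrix_inv M) = transpose (matrix_inv M) ** (M ** matrix_inv M)"
    using inv by simp
  also have "\<dots> = transpose (M ** matrix_inv M) ** matrix_inv M"
    by (simp add: matrix_mul_assoc matrix_transpose_mul \<open>transpose M = M\<close>)
  finally have inv_sym: "transpose (matrix_inv M) = matrix_inv M"
    using inv by (simp add: transpose_mat)
  define B where "B = transpose J ** matrix_inv M"
  have JB: "J ** B = mat 1" using inv by (simp add: B_def M_def matrix_mul_assoc)
  have "pinv J = B"
  proof (rule pinv_eqI)
    show "B ** J ** B = B" using JB by (simp add: matrix_mul_assoc[symmetric])
    show "transpose (B ** J) = B ** J"
      by (simp add: B_def matrix_transpose_mul inv_sym matrix_mul_assoc)
  qed (simp_all add: JB transpose_mat)
  then show "pinv J = transpose J ** matrix_inv (J ** transpose J)" "J ** pinv J = mat 1"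
    using JB by (simp_all add: B_def M_def)
qed

lemma norm_transpose_ge: "s * norm u \<le> norm (transpose J *v u)"
  by (rule norm_transpose_ge_singular_value[OF s_pos s_le])

lemma mult_pinv_vec: "J *v (pinv J *v u) = u"
  by (simp add: matrix_vector_mul_assoc mult_pinv)

text \<open>The vector has the form \<open>transpose J *v w\<close> and squared norm
  \<open>w \<bullet> u\<close>; the lower bound for \<open>transpose J\<close> controls
  \<open>norm w\<close>, and one factor cancels.\<close>

lemma norm_pinv_le: "norm (pinv J *v u) \<le> norm u / s"
proof -
  define w where "w = matrix_inv (J ** transpose J) *v u"
  have p: "pinv J *v u = transpose J *v w"
    by (simp add: w_def pinv_eq matrix_vector_mul_assoc[symmetric])
  have "(norm (pinv J *v u))\<^sup>2 = w \<bullet> u"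
    using mult_pinv_vec[of u] by (simp add: p power2_norm_eq_inner dot_lmul_matrix)
  also have "\<dots> \<le> norm w * norm u" by (rule norm_cauchy_schwarz)
  also have "\<dots> \<le> (norm (pinv J *v u) / s) * norm u"
    using norm_transpose_ge[of w] s_pos by (intro mult_right_mono) (simp_all add: p field_simps)
  finally have "norm (pinv J *v u) * norm (pinv J *v u) \<le> norm (pinv J *v u) * (norm u / s)"
    by (simp add: power2_eq_square)
  then show ?thesis
    using s_pos by (cases "pinv J *v u = 0") (auto simp: mult_le_cancel_left simp del: times_divide_eq_right)
qed

text \<open>Follows by duality from \<open>norm_pinv_le\<close>; it bounds the least-squares
  multiplier.\<close>

lemma norm_transpose_pinv_le: "norm (transpose (pinv J) *v g) \<le> norm g / s"
proof -
  define l where "l = transpose (pinv J) *v g"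
  have "norm l * norm l = g \<bullet> (pinv J *v l)"
    unfolding power2_eq_square[symmetric] power2_norm_eq_inner
    by (simp add: l_def dot_lmul_matrix)
  also have "\<dots> \<le> norm g * norm (pinv J *v l)" by (rule norm_cauchy_schwarz)
  also have "\<dots> \<le> norm g * (norm l / s)" by (intro mult_left_mono norm_pinv_le) simp
  finally have "norm l * norm l \<le> norm l * (norm g / s)" by (simp add: mult.commute)
  then show ?thesis
    unfolding l_def[symmetric] using s_pos
    by (cases "l = 0") (auto simp: mult_le_cancel_left simp del: times_divide_eq_right)
qed

lemma mult_null_proj: "J *v (null_proj J *v x) = 0"
  by (simp add: null_proj_def matrix_vector_mult_diff_rdistrib matrix_vector_mult_diff_distrib
      matrix_vector_mul_assoc[symmetric] mult_pinv_vec)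

lemma inner_pinv_null: "(pinv J *v u) \<bullet> w = 0" if "J *v w = 0"
  using that by (simp add: pinv_eq matrix_vector_mul_assoc[symmetric] dot_lmul_matrix)

end

section \<open>Hessians and Taylor estimates\<close>

text \<open>\<open>grad\<close> is a definite description, so existence and uniqueness of the
  representing vector have to be shown first.\<close>

lemma has_derivative_grad:
  assumes "f differentiable (at x)"
  shows "(f has_derivative (\<lambda>h. h \<bullet> grad f x)) (at x)"
proof -
  obtain f' where f': "(f has_derivative f') (at x)" using assms by (auto simp: differentiable_def)
  then have "linear f'" by (rule has_derivative_linear)
  define g where "g = (\<Sum>b\<in>Basis. f' b *\<^sub>R b)"
  have "f' h = h \<bullet> g" for h
    using Linear_Algebra.linear_componentwise[OF \<open>linear f'\<close>, of h 1]
    by (simp add: g_def inner_sum_right mult.commute)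
  then have "f' = (\<lambda>h. h \<bullet> g)" by (rule ext)
  then have "GDERIV f x :> g" using f' by (simp add: gderiv_def)
  moreover have "g1 = g" if "GDERIV f x :> g1" for g1
  proof -
    have "(\<lambda>h. h \<bullet> g1) = (\<lambda>h. h \<bullet> g)"
      using has_derivative_unique that \<open>GDERIV f x :> g\<close> unfolding gderiv_def by blast
    then have "(g1 - g) \<bullet> g1 = (g1 - g) \<bullet> g" by (rule fun_cong)
    then have "(g1 - g) \<bullet> (g1 - g) = 0" by (simp add: inner_diff_right)
    then show ?thesis by simp
  qed
  ultimately have "GDERIV f x :> grad f x" unfolding grad_def by (rule theI)
  then show ?thesis by (simp add: gderiv_def)
qed

lemma grad_eqI:
  assumes "(f has_derivative (\<lambda>h. h \<bullet> g)) (at x)"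
  shows "grad f x = g"
proof -
  have "f differentiable (at x)" using assms by (auto simp: differentiable_def)
  then have "(\<lambda>h. h \<bullet> grad f x) = (\<lambda>h. h \<bullet> g)"
    using has_derivative_unique has_derivative_grad assms by blast
  then have "(grad f x - g) \<bullet> grad f x = (grad f x - g) \<bullet> g" by (rule fun_cong)
  then have "(grad f x - g) \<bullet> (grad f x - g) = 0" by (simp add: inner_diff_right)
  then show ?thesis by simp
qed

lemma has_derivative_hess:
  assumes "grad f differentiable (at x)"
  shows "(grad f has_derivative (\<lambda>h. hess f x *v h)) (at x)"
  using assms by (simp add: hess_def jacobian_works)

lemma has_real_derivative_along_line:
  assumes "f differentiable (at (x + t *\<^sub>R u))"
  shows "((\<lambda>s. f (x + s *\<^sub>R u)) has_real_derivative u \<bullet> grad f (x + t *\<^sub>R u)) (at t within S)"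
proof -
  have "((\<lambda>s. f (x + s *\<^sub>R u)) has_derivative (\<lambda>h. (h *\<^sub>R u) \<bullet> grad f (x + t *\<^sub>R u))) (at t within S)"
    by (rule has_derivative_compose[where g = f])
      (auto intro!: derivative_eq_intros has_derivative_grad assms)
  then show ?thesis unfolding has_field_derivative_def
    by (rule has_derivative_eq_rhs) (simp add: fun_eq_iff)
qed

text \<open>The double difference \<open>f (x + t u + t v) - f (x + t u) - f (x + t v) + f x\<close> is symmetric in
  \<open>u\<close> and \<open>v\<close>, and up to a multiple of \<open>e t\<^sup>2\<close> it equals \<open>t\<^sup>2 \<langle>H v, u\<rangle>\<close>.\<close>

lemma double_difference_bound:
  fixes f :: "real^'d \<Rightarrow> real"
  assumes f: "\<And>z. f differentiable (at z)"
    and near: "\<And>h. norm h < \<delta> \<Longrightarrow> norm (grad f (x + h) - grad f x - H *v h) \<le> e * norm h"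
    and "0 \<le> e" "0 < t" and small: "t * (norm u + norm v) < \<delta>"
  shows "\<bar>f (x + t *\<^sub>R u + t *\<^sub>R v) - f (x + t *\<^sub>R u) - f (x + t *\<^sub>R v) + f x - t\<^sup>2 * ((H *v v) \<bullet> u)\<bar>
    \<le> e * t\<^sup>2 * (2 * (norm u + norm v)\<^sup>2)"
proof -
  define \<phi> where "\<phi> s = f (x + t *\<^sub>R v + s *\<^sub>R u) - f (x + s *\<^sub>R u)" for s
  define \<phi>' where "\<phi>' s = u \<bullet> grad f (x + t *\<^sub>R v + s *\<^sub>R u) - u \<bullet> grad f (x + s *\<^sub>R u)" for s
  have "(\<phi> has_real_derivative \<phi>' s) (at s)" for s
    unfolding \<phi>_def \<phi>'_def by (intro DERIV_diff has_real_derivative_along_line f)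
  \<comment> \<open>The mean value theorem is applied in the direction \<open>u\<close> only; the
    direction \<open>v\<close> is left to the expansion of \<open>grad f\<close> at
    \<open>x\<close>.\<close>
  then obtain s where s: "0 < s" "s < t" "\<phi> t - \<phi> 0 = (t - 0) * \<phi>' s"
    using MVT2[OF \<open>0 < t\<close>, of \<phi> \<phi>'] by blast
  define R where "R h = grad f (x + h) - grad f x - H *v h" for h
  have R: "norm (R (a *\<^sub>R u + b *\<^sub>R v)) \<le> e * (t * (norm u + norm v))"
    if "0 \<le> a" "a \<le> t" "0 \<le> b" "b \<le> t" for a b
  proof -
    have "norm (a *\<^sub>R u + b *\<^sub>R v) \<le> a * norm u + b * norm v"
      by (rule order_trans[OF norm_triangle_ineq]) (simp add: that)
    also have "\<dots> \<le> t * norm u + t * norm v" by (intro add_mono mult_right_mono that) auto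
    finally have n: "norm (a *\<^sub>R u + b *\<^sub>R v) \<le> t * (norm u + norm v)" by (simp add: distrib_left)
    then have "norm (R (a *\<^sub>R u + b *\<^sub>R v)) \<le> e * norm (a *\<^sub>R u + b *\<^sub>R v)"
      unfolding R_def by (intro near) (use small in linarith)
    also have "\<dots> \<le> e * (t * (norm u + norm v))" by (rule mult_left_mono[OF n \<open>0 \<le> e\<close>])
    finally show ?thesis .
  qed
  \<comment> \<open>The zero multiple of \<open>v\<close> brings both remainders under the bound
    \<open>R\<close>.\<close>
  define r where "r = R (s *\<^sub>R u + t *\<^sub>R v) - R (s *\<^sub>R u + 0 *\<^sub>R v)"
  have "\<phi>' s = u \<bullet> (t *\<^sub>R (H *v v) + r)"
    by (simp add: \<phi>'_def r_def R_def inner_simps matrix_vector_right_distrib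
        matrix_vector_mult_scaleR algebra_simps)
  then have "\<phi> t - \<phi> 0 - t\<^sup>2 * ((H *v v) \<bullet> u) = t * (u \<bullet> r)"
    by (simp add: s(3) inner_simps inner_commute power2_eq_square algebra_simps)
  then have "\<bar>\<phi> t - \<phi> 0 - t\<^sup>2 * ((H *v v) \<bullet> u)\<bar> = t * \<bar>u \<bullet> r\<bar>"
    using \<open>0 < t\<close> by (simp add: abs_mult)
  also have "\<dots> \<le> t * (norm u * norm r)"
    using \<open>0 < t\<close> Cauchy_Schwarz_ineq2[of u r] by simp
  also have "\<dots> \<le> t * ((norm u + norm v) * (2 * (e * (t * (norm u + norm v)))))"
  proof -
    have "norm r \<le> norm (R (s *\<^sub>R u + t *\<^sub>R v)) + norm (R (s *\<^sub>R u + 0 *\<^sub>R v))"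
      unfolding r_def by (rule norm_triangle_ineq4)
    also have "\<dots> \<le> 2 * (e * (t * (norm u + norm v)))"
      using R[of s t] R[of s 0] s \<open>0 < t\<close> by simp
    finally show ?thesis
      using \<open>0 < t\<close> by (intro mult_left_mono mult_mono) auto
  qed
  also have "\<dots> = e * t\<^sup>2 * (2 * (norm u + norm v)\<^sup>2)" by (simp add: power2_eq_square)
  finally show ?thesis by (simp add: \<phi>_def algebra_simps)
qed

text \<open>Compare the double differences for the two orders of \<open>u\<close> and
  \<open>v\<close>, divide by \<open>t\<^sup>2\<close> and let \<open>e\<close> tend to 0. The
  conjugate residual method relies on this symmetry.\<close>

lemma hess_self_adjoint:
  fixes f :: "real^'d \<Rightarrow> real"
  assumes f: "\<And>z. f differentiable (at z)" and g: "grad f differentiable (at x)"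
  shows "(hess f x *v u) \<bullet> v = u \<bullet> (hess f x *v v)"
proof -
  define H where "H = hess f x"
  define N where "N = 4 * (norm u + norm v)\<^sup>2"
  have *: "\<bar>(H *v v) \<bullet> u - (H *v u) \<bullet> v\<bar> \<le> e * N" if "0 < e" for e
  proof -
    obtain \<delta> where \<delta>: "0 < \<delta>"
      "\<And>y. norm (y - x) < \<delta> \<Longrightarrow> norm (grad f y - grad f x - H *v (y - x)) \<le> e * norm (y - x)"
      using has_derivative_hess[OF g] \<open>0 < e\<close> unfolding has_derivative_at_alt H_def by blast
    have near: "norm (grad f (x + h) - grad f x - H *v h) \<le> e * norm h" if "norm h < \<delta>" for h
      using \<delta>(2)[of "x + h"] that by simp
    define t where "t = \<delta> / (norm u + norm v + 1)"
    have pos: "0 < norm u + norm v + 1" by (simp add: add_nonneg_pos)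
    have t: "0 < t" "t * (norm u + norm v) < \<delta>"
    proof -
      show "0 < t" using \<delta>(1) pos by (simp add: t_def)
      have "t * (norm u + norm v + 1) = \<delta>" using pos by (simp add: t_def)
      then show "t * (norm u + norm v) < \<delta>" using \<open>0 < t\<close> by (simp add: distrib_left)
    qed
    define X where "X = f (x + t *\<^sub>R u + t *\<^sub>R v) - f (x + t *\<^sub>R u) - f (x + t *\<^sub>R v) + f x"
    have "\<bar>X - t\<^sup>2 * ((H *v v) \<bullet> u)\<bar> \<le> e * t\<^sup>2 * (2 * (norm u + norm v)\<^sup>2)"
      using double_difference_bound[of f \<delta> x H e t u v] f near t \<open>0 < e\<close> unfolding X_def by simp
    moreover have "\<bar>X - t\<^sup>2 * ((H *v u) \<bullet> v)\<bar> \<le> e * t\<^sup>2 * (2 * (norm u + norm v)\<^sup>2)"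
      using double_difference_bound[of f \<delta> x H e t v u] f near t \<open>0 < e\<close>
      unfolding X_def by (simp add: algebra_simps)
    ultimately have "\<bar>t\<^sup>2 * ((H *v v) \<bullet> u) - t\<^sup>2 * ((H *v u) \<bullet> v)\<bar> \<le> 2 * (e * t\<^sup>2 * (2 * (norm u + norm v)\<^sup>2))"
      by linarith
    then have "\<bar>t\<^sup>2 * ((H *v v) \<bullet> u - (H *v u) \<bullet> v)\<bar> \<le> t\<^sup>2 * (e * N)"
      by (simp add: N_def right_diff_distrib mult_ac)
    then have "t\<^sup>2 * \<bar>(H *v v) \<bullet> u - (H *v u) \<bullet> v\<bar> \<le> t\<^sup>2 * (e * N)"
      by (simp add: abs_mult)
    then show ?thesis using t by simp
  qed
  have "\<bar>(H *v v) \<bullet> u - (H *v u) \<bullet> v\<bar> \<le> 0 + e" if "0 < e" for e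
  proof -
    have "0 \<le> N" by (simp add: N_def)
    then have "e / (N + 1) * N \<le> e" using \<open>0 < e\<close> by (simp add: field_simps)
    then show ?thesis using *[of "e / (N + 1)"] \<open>0 < e\<close> \<open>0 \<le> N\<close> by simp
  qed
  then have "\<bar>(H *v v) \<bullet> u - (H *v u) \<bullet> v\<bar> \<le> 0" by (rule field_le_epsilon)
  then show ?thesis by (simp add: H_def inner_commute)
qed

text \<open>Openness puts short steps in every direction into \<open>D\<close>, so that difference
  quotients see all of \<open>H\<close>. Hence the Hessian bound is derived for open
  \<open>D\<close>.\<close>

lemma derivative_norm_le_lipschitz:
  fixes G :: "real^'d \<Rightarrow> real^'m"
  assumes der: "(G has_derivative (\<lambda>h. H *v h)) (at x)" and "open D" "x \<in> D"
    and lip: "\<And>y. y \<in> D \<Longrightarrow> norm (G y - G x) \<le> K * norm (y - x)"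
  shows "opnorm H \<le> K"
  unfolding opnorm_def
proof (rule onorm_le)
  fix v :: "real^'d"
  obtain r where r: "0 < r" "ball x r \<subseteq> D" using \<open>open D\<close> \<open>x \<in> D\<close> openE by blast
  have *: "norm (H *v v) \<le> (K + e) * norm v" if "0 < e" for e
  proof -
    obtain \<delta> where \<delta>: "0 < \<delta>"
      "\<And>y. norm (y - x) < \<delta> \<Longrightarrow> norm (G y - G x - H *v (y - x)) \<le> e * norm (y - x)"
      using der \<open>0 < e\<close> unfolding has_derivative_at_alt by blast
    define t where "t = min r \<delta> / (norm v + 1)"
    have pos: "0 < norm v + 1" by (simp add: add_nonneg_pos)
    have t: "0 < t" "t * norm v < min r \<delta>"
    proof -
      show "0 < t" using \<delta>(1) r pos by (simp add: t_def)
      have "t * (norm v + 1) = min r \<delta>" using pos by (simp add: t_def)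
      then show "t * norm v < min r \<delta>" using \<open>0 < t\<close> unfolding distrib_left by linarith
    qed
    have "x + t *\<^sub>R v \<in> D" using t r(2) by (auto simp: dist_norm)
    then have "norm (G (x + t *\<^sub>R v) - G x) \<le> K * (t * norm v)"
      using lip[of "x + t *\<^sub>R v"] t by simp
    moreover have "norm (G (x + t *\<^sub>R v) - G x - H *v (t *\<^sub>R v)) \<le> e * (t * norm v)"
      using \<delta>(2)[of "x + t *\<^sub>R v"] t by simp
    ultimately have "norm (H *v (t *\<^sub>R v)) \<le> K * (t * norm v) + e * (t * norm v)"
      using norm_triangle_ineq4[of "G (x + t *\<^sub>R v) - G x" "G (x + t *\<^sub>R v) - G x - H *v (t *\<^sub>R v)"]
      by simp
    then have "t * norm (H *v v) \<le> t * ((K + e) * norm v)"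
      using t by (simp add: matrix_vector_mult_scaleR algebra_simps)
    then show ?thesis using t by simp
  qed
  show "norm (H *v v) \<le> K * norm v"
  proof (rule field_le_epsilon)
    fix e :: real assume "0 < e"
    have "norm (H *v v) \<le> (K + e / (norm v + 1)) * norm v"
      by (rule *) (simp add: \<open>0 < e\<close> add_nonneg_pos)
    also have "\<dots> = K * norm v + e * (norm v / (norm v + 1))" by (simp add: distrib_right)
    also have "e * (norm v / (norm v + 1)) \<le> e * 1"
      using \<open>0 < e\<close> by (intro mult_left_mono) (simp_all add: divide_le_eq_1 add_nonneg_pos)
    finally show "norm (H *v v) \<le> K * norm v + e" by simp
  qed
qed

text \<open>Subtracting the linear and quadratic terms leaves a function with nonpositive
  derivative, which takes the place of an integral.\<close>

lemma quadratic_upper_bound: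
  fixes \<psi> :: "real \<Rightarrow> real"
  assumes der: "\<And>t. 0 \<le> t \<Longrightarrow> t \<le> 1 \<Longrightarrow> (\<psi> has_real_derivative \<psi>' t) (at t)"
    and le: "\<And>t. 0 \<le> t \<Longrightarrow> t \<le> 1 \<Longrightarrow> \<psi>' t \<le> \<psi>' 0 + L * t"
  shows "\<psi> 1 \<le> \<psi> 0 + \<psi>' 0 + L / 2"
proof -
  define \<xi> where "\<xi> t = \<psi> t - \<psi>' 0 * t - L / 2 * t\<^sup>2" for t
  have "\<xi> 1 \<le> \<xi> 0"
  proof (rule DERIV_nonpos_imp_nonincreasing[of 0 1 \<xi>])
    fix t :: real assume t: "0 \<le> t" "t \<le> 1"
    have "(\<xi> has_real_derivative \<psi>' t - \<psi>' 0 - L * t) (at t)"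
      unfolding \<xi>_def by (auto intro!: derivative_eq_intros der t)
    then show "\<exists>y. (\<xi> has_real_derivative y) (at t) \<and> y \<le> 0"
      using le[OF t] by force
  qed simp
  then show ?thesis by (simp add: \<xi>_def)
qed

lemma lipschitz_grad_upper_bound:
  fixes f :: "real^'d \<Rightarrow> real"
  assumes f: "\<And>z. f differentiable (at z)"
    and lip: "\<And>t. 0 \<le> t \<Longrightarrow> t \<le> 1 \<Longrightarrow> norm (grad f (x + t *\<^sub>R p) - grad f x) \<le> L * (t * norm p)"
  shows "f (x + p) \<le> f x + grad f x \<bullet> p + L / 2 * (norm p)\<^sup>2"
proof -
  have "p \<bullet> grad f (x + t *\<^sub>R p) \<le> p \<bullet> grad f (x + 0 *\<^sub>R p) + L * (norm p)\<^sup>2 * t"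
    if "0 \<le> t" "t \<le> 1" for t
  proof -
    have "p \<bullet> (grad f (x + t *\<^sub>R p) - grad f x) \<le> norm p * (L * (t * norm p))"
      by (rule order_trans[OF norm_cauchy_schwarz mult_left_mono[OF lip]]) (simp_all add: that)
    then show ?thesis by (simp add: inner_diff_right power2_eq_square algebra_simps)
  qed
  from quadratic_upper_bound[OF has_real_derivative_along_line[OF f] this]
  show ?thesis by (simp add: inner_commute)
qed

lemma differentiable_componentwise_vec:
  fixes c :: "'a::real_normed_vector \<Rightarrow> real^'c"
  assumes "\<And>i. (\<lambda>z. c z $ i) differentiable (at x)"
  shows "c differentiable (at x)"
  using assms unfolding differentiable_componentwise_within[where f = c]
  by (auto simp: Basis_vec_def inner_axis)

text \<open>Testing the error with its own direction reduces the claim to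
  \<open>quadratic_upper_bound\<close>. As \<open>sgn 0 = 0\<close>, only
  \<open>norm u \<le> 1\<close> is available.\<close>

lemma lipschitz_Jac_bound:
  fixes c :: "real^'d \<Rightarrow> real^'c"
  assumes c: "\<And>z. c differentiable (at z)"
    and lip: "\<And>t. 0 \<le> t \<Longrightarrow> t \<le> 1 \<Longrightarrow> opnorm (Jac c (x + t *\<^sub>R p) - Jac c x) \<le> L * (t * norm p)"
  shows "norm (c (x + p) - c x - Jac c x *v p) \<le> L / 2 * (norm p)\<^sup>2"
proof -
  define e where "e = c (x + p) - c x - Jac c x *v p"
  define u where "u = sgn e"
  have "norm u \<le> 1" by (simp add: u_def norm_sgn)
  define \<psi> \<psi>' where "\<psi> t = u \<bullet> c (x + t *\<^sub>R p)" and "\<psi>' t = u \<bullet> (Jac c (x + t *\<^sub>R p) *v p)" for t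
  have "(\<psi> has_real_derivative \<psi>' t) (at t)" for t
  proof -
    have "((\<lambda>s. c (x + s *\<^sub>R p)) has_derivative (\<lambda>h. Jac c (x + t *\<^sub>R p) *v (h *\<^sub>R p))) (at t)"
      by (rule has_derivative_compose[where g = c])
        (auto intro!: derivative_eq_intros simp: jacobian_works[symmetric] c)
    then have "(\<psi> has_derivative (\<lambda>h. u \<bullet> (Jac c (x + t *\<^sub>R p) *v (h *\<^sub>R p)))) (at t)"
      unfolding \<psi>_def by (rule has_derivative_inner_right)
    then show ?thesis unfolding has_field_derivative_def
      by (rule has_derivative_eq_rhs) (simp add: fun_eq_iff \<psi>'_def matrix_vector_mult_scaleR)
  qed
  moreover have "\<psi>' t \<le> \<psi>' 0 + L * (norm p)\<^sup>2 * t" if "0 \<le> t" "t \<le> 1" for t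
  proof -
    have "u \<bullet> ((Jac c (x + t *\<^sub>R p) - Jac c x) *v p) \<le>
        norm u * norm ((Jac c (x + t *\<^sub>R p) - Jac c x) *v p)"
      by (rule norm_cauchy_schwarz)
    also have "\<dots> \<le> 1 * norm ((Jac c (x + t *\<^sub>R p) - Jac c x) *v p)"
      by (intro mult_right_mono \<open>norm u \<le> 1\<close>) simp
    also have "\<dots> \<le> opnorm (Jac c (x + t *\<^sub>R p) - Jac c x) * norm p"
      by (simp add: norm_matrix_vector_le_opnorm)
    also have "\<dots> \<le> L * (t * norm p) * norm p" by (intro mult_right_mono lip that) simp
    finally show ?thesis
      by (simp add: \<psi>'_def matrix_vector_mult_diff_rdistrib inner_diff_right power2_eq_square
          algebra_simps)
  qed
  ultimately have "\<psi> 1 \<le> \<psi> 0 + \<psi>' 0 + L * (norm p)\<^sup>2 / 2" by (rule quadratic_upper_bound)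
  then have "u \<bullet> e \<le> L / 2 * (norm p)\<^sup>2"
    by (simp add: \<psi>_def \<psi>'_def e_def inner_simps)
  moreover have "u \<bullet> e = norm e"
    by (cases "e = 0") (simp_all add: u_def sgn_div_norm power2_norm_eq_inner[symmetric] power2_eq_square)
  ultimately show ?thesis by (simp add: e_def)
qed

section \<open>Gradient and Hessian of the Lagrangian\<close>

locale smooth_problem =
  fixes f :: "real^'d \<Rightarrow> real" and c :: "real^'d \<Rightarrow> real^'c"
  assumes f_C2: "C2 f" and c_C2: "\<And>i. C2 (\<lambda>x. c x $ i)"
begin

lemma f_differentiable: "f differentiable (at x)"
  using f_C2 by (simp add: C2_def)

lemma c_differentiable: "c differentiable (at x)"
  using c_C2 by (intro differentiable_componentwise_vec) (simp add: C2_def)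

lemma has_derivative_lagrangian:
  "((\<lambda>z. lagrangian f c z l) has_derivative (\<lambda>h. h \<bullet> (grad f x + transpose (Jac c x) *v l))) (at x)"
proof -
  have "((\<lambda>z. lagrangian f c z l) has_derivative (\<lambda>h. h \<bullet> grad f x + l \<bullet> (Jac c x *v h))) (at x)"
    unfolding lagrangian_def
    by (intro has_derivative_add has_derivative_grad f_differentiable has_derivative_inner_right)
      (simp add: jacobian_works[symmetric] c_differentiable)
  then show ?thesis
    by (simp add: inner_add_right dot_lmul_matrix[symmetric] inner_commute)
qed

lemma grad_lagrangian: "grad (\<lambda>z. lagrangian f c z l) x = grad f x + transpose (Jac c x) *v l"
  by (rule grad_eqI[OF has_derivative_lagrangian])

lemma lagrangian_differentiable: "(\<lambda>z. lagrangian f c z l) differentiable (at x)"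
  using has_derivative_lagrangian by (auto simp: differentiable_def)

text \<open>The gradient is expanded over the components of \<open>c\<close>, because smoothness is
  assumed of their gradients; the Jacobian form in \<open>grad_lagrangian\<close> suits Lipschitz
  estimates.\<close>

lemma grad_lagrangian_differentiable: "grad (\<lambda>z. lagrangian f c z l) differentiable (at x)"
proof -
  have comp: "(\<lambda>z. c z $ i) differentiable (at x)" for i x using c_C2[of i] by (simp add: C2_def)
  have "grad (\<lambda>z. lagrangian f c z l) x = grad f x + (\<Sum>i\<in>UNIV. l $ i *\<^sub>R grad (\<lambda>z. c z $ i) x)" for x
  proof (rule grad_eqI)
    have "((\<lambda>z. f z + (\<Sum>i\<in>UNIV. l $ i * c z $ i)) has_derivative
        (\<lambda>h. h \<bullet> grad f x + (\<Sum>i\<in>UNIV. l $ i * (h \<bullet> grad (\<lambda>z. c z $ i) x)))) (at x)"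
      by (intro has_derivative_add has_derivative_sum has_derivative_mult_right
          has_derivative_grad f_differentiable comp)
    then show "((\<lambda>z. lagrangian f c z l) has_derivative
        (\<lambda>h. h \<bullet> (grad f x + (\<Sum>i\<in>UNIV. l $ i *\<^sub>R grad (\<lambda>z. c z $ i) x)))) (at x)"
      by (simp add: lagrangian_def inner_vec_def[of l] inner_add_right inner_sum_right)
  qed
  then have "grad (\<lambda>z. lagrangian f c z l) = (\<lambda>x. grad f x + (\<Sum>i\<in>UNIV. l $ i *\<^sub>R grad (\<lambda>z. c z $ i) x))"
    by blast
  moreover have "(\<lambda>x. grad f x + (\<Sum>i\<in>UNIV. l $ i *\<^sub>R grad (\<lambda>z. c z $ i) x)) differentiable (at x)"
    using f_C2 c_C2 by (intro differentiable_add differentiable_sum differentiable_scaleR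
        differentiable_const) (auto simp: C2_def)
  ultimately show ?thesis by simp
qed

lemma dpd_hess_self_adjoint: "(dpd_hess f c b x *v u) \<bullet> v = u \<bullet> (dpd_hess f c b x *v v)"
  unfolding dpd_hess_def
  by (intro hess_self_adjoint lagrangian_differentiable grad_lagrangian_differentiable)

end

section \<open>Complexity of the algorithm\<close>

lemma norm_transpose_vec_le: "norm (transpose M *v u) \<le> opnorm M * norm u"
  for M :: "real^'n^'m"
proof -
  define w where "w = transpose M *v u"
  have "norm w * norm w = u \<bullet> (M *v w)"
    unfolding power2_eq_square[symmetric] power2_norm_eq_inner by (simp add: w_def dot_lmul_matrix)
  also have "\<dots> \<le> norm u * norm (M *v w)" by (rule norm_cauchy_schwarz)
  also have "\<dots> \<le> norm u * (opnorm M * norm w)"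
    by (intro mult_left_mono norm_matrix_vector_le_opnorm) simp
  finally have "norm w * norm w \<le> norm w * (opnorm M * norm u)" by (simp add: mult_ac)
  then show ?thesis unfolding w_def[symmetric]
    using opnorm_nonneg[of M] by (cases "w = 0") (auto simp: mult_le_cancel_left)
qed

text \<open>Either the unit step is accepted, or the previous trial was rejected and so exceeded
  \<open>T\<close>, and the accepted step is \<open>theta A\<close> times that trial.\<close>

lemma backtracking_obtains:
  assumes \<theta>: "0 < theta A" "theta A < 1" and "0 < T"
    and armijo: "\<And>\<alpha>. 0 < \<alpha> \<Longrightarrow> \<alpha> \<le> 1 \<Longrightarrow> \<alpha> \<le> T \<Longrightarrow> armijo A f c x p \<pi> \<alpha>"
  obtains \<alpha> where "backtracking A f c x p \<pi> = Some \<alpha>" "armijo A f c x p \<pi> \<alpha>"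
    "min 1 (theta A * T) \<le> \<alpha>"
proof -
  have \<theta>_pow: "0 < theta A ^ i" "theta A ^ i \<le> 1" for i
    using \<theta> by (simp_all add: power_le_one)
  obtain n where "theta A ^ n < T" using real_arch_pow_inv[OF \<open>0 < T\<close> \<theta>(2)] by blast
  then have ex: "\<exists>j. armijo A f c x p \<pi> (theta A ^ j)"
    using armijo[of "theta A ^ n"] \<theta>_pow by (intro exI[of _ n]) simp
  define j where "j = (LEAST j. armijo A f c x p \<pi> (theta A ^ j))"
  have j: "armijo A f c x p \<pi> (theta A ^ j)" unfolding j_def by (rule LeastI_ex[OF ex])
  have "min 1 (theta A * T) \<le> theta A ^ j"
  proof (cases j)
    case (Suc i)
    then have "\<not> armijo A f c x p \<pi> (theta A ^ i)"
      using not_less_Least[of i "\<lambda>j. armijo A f c x p \<pi> (theta A ^ j)"] by (simp add: j_def)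
    then have "T \<le> theta A ^ i" using armijo[of "theta A ^ i"] \<theta>_pow[of i] by force
    then show ?thesis using Suc \<theta> by (simp add: min.coboundedI2)
  qed simp
  then show thesis using that[of "theta A ^ j"] j ex by (simp add: backtracking_def j_def)
qed

locale dpd_run = smooth_problem f c
  for f :: "real^'d \<Rightarrow> real" and c :: "real^'d \<Rightarrow> real^'c" +
  fixes A :: "('d, 'c) dpd_params" and ls :: "nat \<Rightarrow> bool" and Z :: "nat \<Rightarrow> (real^'d) list"
    and D :: "(real^'d) set" and \<sigma>\<^sub>J L\<^sub>f L\<^sub>c f\<^sub>l\<^sub>o\<^sub>w \<kappa>\<^sub>g \<kappa>\<^sub>c :: real
  assumes params: "valid_params A"
    and factors: "(k, x) \<in> dpd_active A f c ls Z \<Longrightarrow>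
      is_orthonormal_factor (Z k) (null_proj (Jac c x))"
    and domain: "iterates_and_trials A f c ls Z \<union> search_segments A f c ls Z \<subseteq> D"
    and \<sigma>\<^sub>J_pos: "0 < \<sigma>\<^sub>J"
    and singular_value_ge: "x \<in> iterates_and_trials A f c ls Z \<Longrightarrow>
      \<sigma>\<^sub>J \<le> singular_value (Jac c x) CARD('c)"
    and lipschitz_f: "L\<^sub>f-lipschitz_on D (grad f)"
    and L\<^sub>c_nonneg: "0 \<le> L\<^sub>c"
    and lipschitz_c: "x \<in> D \<Longrightarrow> y \<in> D \<Longrightarrow> opnorm (Jac c x - Jac c y) \<le> L\<^sub>c * dist x y"
    and f_ge: "x \<in> iterates_and_trials A f c ls Z \<Longrightarrow> f\<^sub>l\<^sub>o\<^sub>w \<le> f x"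
    and grad_le: "x \<in> iterates_and_trials A f c ls Z \<Longrightarrow> norm (grad f x) \<le> \<kappa>\<^sub>g"
    and c_le: "x \<in> iterates_and_trials A f c ls Z \<Longrightarrow> norm (c x) \<le> \<kappa>\<^sub>c"
begin

section \<open>Constants of the bound and their signs\<close>

lemma param_bounds:
  "0 < eps_c A" "0 < eps_p A" "0 < tau_tan A" "0 < sigma A" "0 < rho A" "rho A < 1"
  "0 < eta A" "eta A < 1" "0 < theta A" "theta A < 1" "0 < pi_init A"
  using params by (simp_all add: valid_params_def)

lemma iterate: "dpd_state A f c ls Z k = Some (x, l, \<pi>) \<Longrightarrow> x \<in> iterates_and_trials A f c ls Z"
  by (auto simp: iterates_and_trials_def)

lemma L\<^sub>f_nonneg: "0 \<le> L\<^sub>f"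
  using lipschitz_f by (rule lipschitz_on_nonneg)

lemma pi_bar_pos: "0 < pi_bar A \<kappa>\<^sub>g \<sigma>\<^sub>J"
  using param_bounds by (simp add: pi_bar_def less_max_iff_disj)

lemma gamma_tan_pos: "0 < gamma_tan A"
  using param_bounds by (simp add: gamma_tan_def)

lemma omega_tan_pos: "0 < omega_tan A \<kappa>"
proof -
  have "0 < (tau_tan A)\<^sup>2 + \<kappa>\<^sup>2" using param_bounds by (simp add: add_pos_nonneg)
  then show ?thesis using param_bounds by (simp add: omega_tan_def Let_def)
qed

text \<open>The denominator in \<open>alpha_bar\<close>. It bounds the second-order term of the
  merit function per unit of \<open>norm (c x) + (norm w)\<^sup>2\<close>;
  \<open>descent_const\<close> is the guaranteed model decrease in the same unit.\<close>

definition curvature_const :: real where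
  "curvature_const = (pi_bar A \<kappa>\<^sub>g \<sigma>\<^sub>J * L\<^sub>c + L\<^sub>f) * max 1 (\<kappa>\<^sub>c / \<sigma>\<^sub>J\<^sup>2)"

definition descent_const :: real where
  "descent_const = min (gamma_tan A) (pi_init A * rho A)"

text \<open>The value \<open>1 / theta A\<close> for zero curvature makes
  \<open>theta A * step_threshold\<close> equal to the default 1 in
  \<open>alpha_bar\<close>.\<close>

definition step_threshold :: real where
  "step_threshold = (if curvature_const = 0 then 1 / theta A
     else 2 * (1 - eta A) * descent_const / curvature_const)"

lemma curvature_const_nonneg: "0 \<le> curvature_const"
  using pi_bar_pos L\<^sub>c_nonneg L\<^sub>f_nonneg
  by (simp add: curvature_const_def mult_nonneg_nonneg le_max_iff_disj)

lemma descent_const_pos: "0 < descent_const"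
  using gamma_tan_pos param_bounds by (simp add: descent_const_def)

lemma step_threshold_pos: "0 < step_threshold"
  using curvature_const_nonneg descent_const_pos param_bounds by (simp add: step_threshold_def)

lemma alpha_bar_eq: "alpha_bar A L\<^sub>f L\<^sub>c \<kappa>\<^sub>g \<kappa>\<^sub>c \<sigma>\<^sub>J = min 1 (theta A * step_threshold)"
  using param_bounds
  by (simp add: alpha_bar_def Let_def curvature_const_def[symmetric] descent_const_def[symmetric]
      step_threshold_def)

lemma alpha_bar_pos: "0 < alpha_bar A L\<^sub>f L\<^sub>c \<kappa>\<^sub>g \<kappa>\<^sub>c \<sigma>\<^sub>J"
  using step_threshold_pos param_bounds by (simp add: alpha_bar_eq)

lemma Gamma_c_pos: "0 < Gamma_c A L\<^sub>f L\<^sub>c \<kappa>\<^sub>g \<kappa>\<^sub>c \<sigma>\<^sub>J"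
  using alpha_bar_pos param_bounds by (simp add: Gamma_c_def)

lemma Gamma_p_pos: "0 < Gamma_p A L\<^sub>f L\<^sub>c \<kappa>\<^sub>g \<kappa>\<^sub>c \<sigma>\<^sub>J \<kappa>"
  using alpha_bar_pos param_bounds gamma_tan_pos omega_tan_pos[of \<kappa>] pi_bar_pos
  by (simp add: Gamma_p_def)

lemma Jac_full_row_rank:
  "x \<in> iterates_and_trials A f c ls Z \<Longrightarrow> full_row_rank (Jac c x) \<sigma>\<^sub>J"
  using \<sigma>\<^sub>J_pos singular_value_ge by unfold_locales

text \<open>For a fixed multiplier \<open>l\<close>, the change of the gradient of the Lagrangian
  from \<open>x\<close> is Lipschitz with constant \<open>L\<^sub>f + L\<^sub>c * norm l\<close>,
  and both admissible multipliers have norm at most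
  \<open>\<kappa>\<^sub>g / \<sigma>\<^sub>J\<close>.\<close>

lemma lagrangian_hess_bounded:
  assumes "open D"
  shows "lagrangian_hess_bound A f c ls Z (L\<^sub>f + L\<^sub>c * (\<kappa>\<^sub>g / \<sigma>\<^sub>J))"
  unfolding lagrangian_hess_bound_def
proof (clarify)
  fix k x assume "(k, x) \<in> dpd_active A f c ls Z"
  then have x: "x \<in> iterates_and_trials A f c ls Z"
    by (auto simp: dpd_active_def iterates_and_trials_def)
  then have "x \<in> D" using domain by blast
  interpret full_row_rank "Jac c x" \<sigma>\<^sub>J by (rule Jac_full_row_rank[OF x])
  define l where "l = dpd_multiplier f c (ls k) x"
  have "norm l \<le> norm (grad f x) / \<sigma>\<^sub>J"
    using norm_transpose_pinv_le[of "grad f x"] \<sigma>\<^sub>J_pos by (simp add: l_def dpd_multiplier_def)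
  also have "\<dots> \<le> \<kappa>\<^sub>g / \<sigma>\<^sub>J" using grad_le[OF x] \<sigma>\<^sub>J_pos by (simp add: divide_right_mono)
  finally have l: "norm l \<le> \<kappa>\<^sub>g / \<sigma>\<^sub>J" .
  show "opnorm (dpd_hess f c (ls k) x) \<le> L\<^sub>f + L\<^sub>c * (\<kappa>\<^sub>g / \<sigma>\<^sub>J)"
    unfolding dpd_hess_def l_def[symmetric]
  proof (rule derivative_norm_le_lipschitz[OF has_derivative_hess \<open>open D\<close> \<open>x \<in> D\<close>])
    show "grad (\<lambda>z. lagrangian f c z l) differentiable (at x)"
      by (rule grad_lagrangian_differentiable)
    fix y assume "y \<in> D"
    have "transpose (Jac c y) *v l - transpose (Jac c x) *v l = transpose (Jac c y - Jac c x) *v l"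
      by (simp add: matrix_vector_mult_def transpose_def vec_eq_iff sum_subtractf[symmetric]
          left_diff_distrib del: transpose_matrix_vector)
    then have "grad (\<lambda>z. lagrangian f c z l) y - grad (\<lambda>z. lagrangian f c z l) x =
        (grad f y - grad f x) + transpose (Jac c y - Jac c x) *v l"
      by (simp only: grad_lagrangian) (metis add_diff_add)
    then have "norm (grad (\<lambda>z. lagrangian f c z l) y - grad (\<lambda>z. lagrangian f c z l) x) \<le>
        norm (grad f y - grad f x) + norm (transpose (Jac c y - Jac c x) *v l)"
      by (simp only: norm_triangle_ineq)
    also have "norm (grad f y - grad f x) \<le> L\<^sub>f * norm (y - x)"
      using lipschitz_onD[OF lipschitz_f \<open>y \<in> D\<close> \<open>x \<in> D\<close>] by (simp add: dist_norm)
    also have "norm (transpose (Jac c y - Jac c x) *v l) \<le> (L\<^sub>c * norm (y - x)) * (\<kappa>\<^sub>g / \<sigma>\<^sub>J)"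
    proof (rule order_trans[OF norm_transpose_vec_le mult_mono])
      show "opnorm (Jac c y - Jac c x) \<le> L\<^sub>c * norm (y - x)"
        using lipschitz_c[OF \<open>y \<in> D\<close> \<open>x \<in> D\<close>] by (simp add: dist_norm)
    qed (use l L\<^sub>c_nonneg in simp_all)
    finally show "norm (grad (\<lambda>z. lagrangian f c z l) y - grad (\<lambda>z. lagrangian f c z l) x) \<le>
        (L\<^sub>f + L\<^sub>c * (\<kappa>\<^sub>g / \<sigma>\<^sub>J)) * norm (y - x)"
      by (simp add: algebra_simps)
  qed
qed

text \<open>For \<open>\<pi> > 0\<close> this is
  \<open>(merit f c x \<pi> - f\<^sub>l\<^sub>o\<^sub>w) / \<pi>\<close>. Its initial value is the
  numerator in \<open>K\<close>.\<close>

definition potential :: "real^'d \<Rightarrow> real \<Rightarrow> real" where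
  "potential x \<pi> = (f x - f\<^sub>l\<^sub>o\<^sub>w) / \<pi> + norm (c x)"

definition decrease :: "real \<Rightarrow> real" where
  "decrease \<kappa> = min (Gamma_c A L\<^sub>f L\<^sub>c \<kappa>\<^sub>g \<kappa>\<^sub>c \<sigma>\<^sub>J) (Gamma_p A L\<^sub>f L\<^sub>c \<kappa>\<^sub>g \<kappa>\<^sub>c \<sigma>\<^sub>J \<kappa>) *
     min (eps_c A) ((eps_p A)\<^sup>2)"

lemma decrease_pos: "0 < decrease \<kappa>"
  using Gamma_c_pos Gamma_p_pos param_bounds by (simp add: decrease_def)

text \<open>One half of the stopping test fails, and the matching summand alone suffices: the
  constraint term pays for \<open>Gamma_c\<close>, the tangential term for
  \<open>Gamma_p\<close>.\<close>

lemma decrease_le: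
  assumes "\<not> dpd_stop A f c x" and w: "omega_tan A \<kappa> * norm (null_proj (Jac c x) *v grad f x) \<le> norm w"
  shows "decrease \<kappa> \<le> alpha_bar A L\<^sub>f L\<^sub>c \<kappa>\<^sub>g \<kappa>\<^sub>c \<sigma>\<^sub>J * eta A *
    (rho A * norm (c x) + gamma_tan A * (norm w)\<^sup>2 / pi_bar A \<kappa>\<^sub>g \<sigma>\<^sub>J)"
proof -
  define a where "a = alpha_bar A L\<^sub>f L\<^sub>c \<kappa>\<^sub>g \<kappa>\<^sub>c \<sigma>\<^sub>J * eta A"
  have "0 < a" using alpha_bar_pos param_bounds by (simp add: a_def)
  define G\<^sub>c G\<^sub>p where "G\<^sub>c = Gamma_c A L\<^sub>f L\<^sub>c \<kappa>\<^sub>g \<kappa>\<^sub>c \<sigma>\<^sub>J" and "G\<^sub>p = Gamma_p A L\<^sub>f L\<^sub>c \<kappa>\<^sub>g \<kappa>\<^sub>c \<sigma>\<^sub>J \<kappa>"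
  have G: "0 < G\<^sub>c" "0 < G\<^sub>p" using Gamma_c_pos Gamma_p_pos by (simp_all add: G\<^sub>c_def G\<^sub>p_def)
  define s t where "s = rho A * norm (c x)" and "t = gamma_tan A * (norm w)\<^sup>2 / pi_bar A \<kappa>\<^sub>g \<sigma>\<^sub>J"
  have st: "0 \<le> s" "0 \<le> t"
    using param_bounds gamma_tan_pos pi_bar_pos by (simp_all add: s_def t_def)
  consider "eps_c A < norm (c x)" | "eps_p A < norm (null_proj (Jac c x) *v grad f x)"
    using assms(1) by (auto simp: dpd_stop_def)
  then have "decrease \<kappa> \<le> a * (s + t)"
  proof cases
    case 1
    have "decrease \<kappa> \<le> G\<^sub>c * eps_c A"
      unfolding decrease_def G\<^sub>c_def[symmetric] G\<^sub>p_def[symmetric]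
      using G param_bounds by (intro mult_mono) auto
    also have "\<dots> = a * (rho A * eps_c A)" by (simp add: G\<^sub>c_def Gamma_c_def a_def)
    also have "\<dots> \<le> a * (s + t)"
      using 1 \<open>0 < a\<close> st param_bounds by (intro mult_left_mono) (simp_all add: s_def add_increasing2)
    finally show ?thesis .
  next
    case 2
    have "omega_tan A \<kappa> * eps_p A \<le> norm w"
      using 2 w mult_left_mono[of "eps_p A" _ "omega_tan A \<kappa>"] omega_tan_pos[of \<kappa>]
      by (meson less_imp_le order_trans)
    then have "(omega_tan A \<kappa> * eps_p A)\<^sup>2 \<le> (norm w)\<^sup>2"
      using omega_tan_pos[of \<kappa>] param_bounds by (intro power_mono) auto
    then have le: "gamma_tan A * (omega_tan A \<kappa> * eps_p A)\<^sup>2 / pi_bar A \<kappa>\<^sub>g \<sigma>\<^sub>J \<le> t"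
      unfolding t_def using gamma_tan_pos pi_bar_pos
      by (intro divide_right_mono mult_left_mono) auto
    have "decrease \<kappa> \<le> G\<^sub>p * (eps_p A)\<^sup>2"
      unfolding decrease_def G\<^sub>c_def[symmetric] G\<^sub>p_def[symmetric]
      using G param_bounds by (intro mult_mono) auto
    also have "\<dots> = a * (gamma_tan A * (omega_tan A \<kappa> * eps_p A)\<^sup>2 / pi_bar A \<kappa>\<^sub>g \<sigma>\<^sub>J)"
      by (simp add: G\<^sub>p_def Gamma_p_def a_def power_mult_distrib)
    also have "\<dots> \<le> a * (s + t)"
      using le \<open>0 < a\<close> st by (intro mult_left_mono) auto
    finally show ?thesis .
  qed
  then show ?thesis by (simp add: a_def s_def t_def)
qed

section \<open>One iteration that passes the stopping test\<close>

context
  fixes k x l \<pi>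
  assumes state: "dpd_state A f c ls Z k = Some (x, l, \<pi>)"
    and active: "\<not> dpd_stop A f c x"
    and \<pi>_ge: "pi_init A \<le> \<pi>" and \<pi>_le: "\<pi> \<le> pi_bar A \<kappa>\<^sub>g \<sigma>\<^sub>J"
begin

interpretation full_row_rank "Jac c x" \<sigma>\<^sub>J
  by (rule Jac_full_row_rank[OF iterate[OF state]])

interpretation orthonormal_factor "Z k" "null_proj (Jac c x)"
  using factors[of k x] state active by unfold_locales (auto simp: dpd_active_def)

abbreviation v where "v \<equiv> dpd_normal c x"
abbreviation \<pi>' where "\<pi>' \<equiv> dpd_penalty A f c x \<pi>"

lemma norm_normal_le: "norm v \<le> norm (c x) / \<sigma>\<^sub>J"
  using norm_pinv_le[of "c x"] by (simp add: dpd_normal_def)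

lemma Jac_normal: "Jac c x *v v = - c x"
  by (simp add: dpd_normal_def mult_pinv_vec linear_neg[OF matrix_vector_mul_linear])

text \<open>\<open>norm v\<close> is at most \<open>norm (c x) / \<sigma>\<^sub>J\<close>, so
  \<open>norm (c x)\<close> cancels in the trial value and the first entry of \<open>pi_bar\<close>
  remains.\<close>

lemma penalty_bounds: "\<pi> \<le> \<pi>'" "\<pi>' \<le> pi_bar A \<kappa>\<^sub>g \<sigma>\<^sub>J"
proof -
  show "\<pi> \<le> \<pi>'" by (simp add: dpd_penalty_def)
  have "grad f x \<bullet> v / ((1 - rho A) * norm (c x)) \<le> \<kappa>\<^sub>g / ((1 - rho A) * \<sigma>\<^sub>J)" if "c x \<noteq> 0"
  proof -
    have "grad f x \<bullet> v \<le> norm (grad f x) * norm v" by (rule norm_cauchy_schwarz)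
    also have "\<dots> \<le> \<kappa>\<^sub>g * (norm (c x) / \<sigma>\<^sub>J)"
      using grad_le[OF iterate[OF state]] order_trans[OF norm_ge_zero grad_le[OF iterate[OF state]]]
      by (intro mult_mono norm_normal_le) auto
    finally show ?thesis
      using that \<sigma>\<^sub>J_pos param_bounds by (simp add: divide_simps mult_ac)
  qed
  moreover have "0 \<le> \<pi>" using \<pi>_ge param_bounds by simp
  ultimately show "\<pi>' \<le> pi_bar A \<kappa>\<^sub>g \<sigma>\<^sub>J"
    using \<pi>_le pi_bar_pos unfolding dpd_penalty_def by (auto simp: pi_bar_def)
qed

lemma penalty_pos: "0 < \<pi>'"
  using penalty_bounds \<pi>_ge param_bounds by linarith

text \<open>The trial penalty is made for this inequality: of the gain
  \<open>\<pi>' * norm (c x)\<close> in the model, the fraction \<open>rho A\<close>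
  survives.\<close>

lemma inner_grad_normal_le: "grad f x \<bullet> v \<le> (1 - rho A) * \<pi>' * norm (c x)"
proof (cases "c x = 0")
  case True
  then show ?thesis by (simp add: dpd_normal_def)
next
  case False
  then have "grad f x \<bullet> v / ((1 - rho A) * norm (c x)) \<le> \<pi>'" by (simp add: dpd_penalty_def)
  then show ?thesis using False param_bounds by (simp add: divide_le_eq mult_ac)
qed

context
  fixes w
  assumes tangential: "dpd_tangential A f c (ls k) (Z k) x = Some w"
    and w_proj: "null_proj (Jac c x) *v w = w"
    and w_descent: "grad f x \<bullet> w \<le> - (gamma_tan A * (norm w)\<^sup>2)"
begin

abbreviation p where "p \<equiv> v + w"

lemma Jac_tangential: "Jac c x *v w = 0"
  using mult_null_proj[of w] w_proj by simp

lemma Dbar_eq: "Dbar f c x p \<pi>' = grad f x \<bullet> p - \<pi>' * norm (c x)"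
  by (simp add: Dbar_def matrix_vector_right_distrib Jac_normal Jac_tangential)

lemma Dbar_le: "Dbar f c x p \<pi>' \<le> - (rho A * \<pi>' * norm (c x) + gamma_tan A * (norm w)\<^sup>2)"
  unfolding Dbar_eq using inner_grad_normal_le w_descent by (simp add: inner_add_right algebra_simps)

text \<open>\<open>v\<close> and \<open>w\<close> are orthogonal. The square of
  \<open>norm v\<close> is quadratic in \<open>norm (c x)\<close>, while the model decrease is
  linear in it; bounding one factor by \<open>\<kappa>\<^sub>c\<close> gives
  \<open>\<kappa>\<^sub>c / \<sigma>\<^sub>J\<^sup>2\<close>.\<close>

lemma norm_step_le: "(norm p)\<^sup>2 \<le> max 1 (\<kappa>\<^sub>c / \<sigma>\<^sub>J\<^sup>2) * (norm (c x) + (norm w)\<^sup>2)"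
proof -
  have "v \<bullet> w = 0" using inner_pinv_null[OF Jac_tangential] by (simp add: dpd_normal_def)
  then have "(norm p)\<^sup>2 = (norm v)\<^sup>2 + (norm w)\<^sup>2"
    by (simp add: power2_norm_eq_inner inner_simps inner_commute)
  also have "\<dots> \<le> max 1 (\<kappa>\<^sub>c / \<sigma>\<^sub>J\<^sup>2) * norm (c x) + max 1 (\<kappa>\<^sub>c / \<sigma>\<^sub>J\<^sup>2) * (norm w)\<^sup>2"
  proof (rule add_mono)
    have "(norm v)\<^sup>2 \<le> (norm (c x) / \<sigma>\<^sub>J)\<^sup>2" by (rule power_mono[OF norm_normal_le]) simp
    also have "\<dots> = norm (c x) / \<sigma>\<^sub>J\<^sup>2 * norm (c x)" by (simp add: power2_eq_square)
    also have "\<dots> \<le> \<kappa>\<^sub>c / \<sigma>\<^sub>J\<^sup>2 * norm (c x)"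
      using c_le[OF iterate[OF state]] by (intro mult_right_mono divide_right_mono) auto
    also have "\<dots> \<le> max 1 (\<kappa>\<^sub>c / \<sigma>\<^sub>J\<^sup>2) * norm (c x)" by (intro mult_right_mono) auto
    finally show "(norm v)\<^sup>2 \<le> max 1 (\<kappa>\<^sub>c / \<sigma>\<^sub>J\<^sup>2) * norm (c x)" .
    show "(norm w)\<^sup>2 \<le> max 1 (\<kappa>\<^sub>c / \<sigma>\<^sub>J\<^sup>2) * (norm w)\<^sup>2"
      using mult_right_mono[of 1 "max 1 (\<kappa>\<^sub>c / \<sigma>\<^sub>J\<^sup>2)" "(norm w)\<^sup>2"] by simp
  qed
  finally show ?thesis by (simp add: distrib_left)
qed

lemma segment_in_domain:
  assumes "0 \<le> t" "t \<le> 1" shows "x + t *\<^sub>R p \<in> D"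
proof -
  have "(x, p, \<pi>') \<in> dpd_searches A f c ls Z"
    unfolding dpd_searches_def using state active tangential by blast
  moreover have "x + t *\<^sub>R p \<in> closed_segment x (x + p)"
    unfolding in_segment using assms by (intro exI[of _ t]) (simp add: algebra_simps)
  ultimately show ?thesis using domain unfolding search_segments_def by blast
qed

lemma merit_le:
  assumes \<alpha>: "0 \<le> \<alpha>" "\<alpha> \<le> 1"
  shows "merit f c (x + \<alpha> *\<^sub>R p) \<pi>' \<le>
    merit f c x \<pi>' + \<alpha> * Dbar f c x p \<pi>' + \<alpha>\<^sup>2 / 2 * (L\<^sub>f + \<pi>' * L\<^sub>c) * (norm p)\<^sup>2"
proof -
  have in_D: "x + t *\<^sub>R (\<alpha> *\<^sub>R p) \<in> D" if "0 \<le> t" "t \<le> 1" for t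
    using segment_in_domain[of "t * \<alpha>"] that \<alpha> by (simp add: mult_le_one)
  have "x \<in> D" using in_D[of 0] by simp
  have f: "f (x + \<alpha> *\<^sub>R p) \<le> f x + grad f x \<bullet> (\<alpha> *\<^sub>R p) + L\<^sub>f / 2 * (norm (\<alpha> *\<^sub>R p))\<^sup>2"
  proof (rule lipschitz_grad_upper_bound[OF f_differentiable])
    fix t :: real assume t: "0 \<le> t" "t \<le> 1"
    show "norm (grad f (x + t *\<^sub>R \<alpha> *\<^sub>R p) - grad f x) \<le> L\<^sub>f * (t * norm (\<alpha> *\<^sub>R p))"
      using lipschitz_onD[OF lipschitz_f in_D[OF t] \<open>x \<in> D\<close>] t by (simp add: dist_norm abs_mult mult_ac)
  qed
  have "norm (c (x + \<alpha> *\<^sub>R p) - c x - Jac c x *v (\<alpha> *\<^sub>R p)) \<le> L\<^sub>c / 2 * (norm (\<alpha> *\<^sub>R p))\<^sup>2"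
  proof (rule lipschitz_Jac_bound[OF c_differentiable])
    fix t :: real assume t: "0 \<le> t" "t \<le> 1"
    show "opnorm (Jac c (x + t *\<^sub>R \<alpha> *\<^sub>R p) - Jac c x) \<le> L\<^sub>c * (t * norm (\<alpha> *\<^sub>R p))"
      using lipschitz_c[OF in_D[OF t] \<open>x \<in> D\<close>] t by (simp add: dist_norm abs_mult mult_ac)
  qed
  \<comment> \<open>For \<open>\<alpha> \<le> 1\<close> the norm of the linearised constraint is
    thus affine in \<open>\<alpha>\<close>, matching \<open>\<alpha> * Dbar\<close> exactly.\<close>
  moreover have "c x + Jac c x *v (\<alpha> *\<^sub>R p) = (1 - \<alpha>) *\<^sub>R c x"
    by (simp add: matrix_vector_right_distrib matrix_vector_mult_scaleR Jac_normal Jac_tangential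
        scaleR_left_diff_distrib)
  moreover have "norm (c (x + \<alpha> *\<^sub>R p)) \<le> norm (c x + Jac c x *v (\<alpha> *\<^sub>R p)) +
      norm (c (x + \<alpha> *\<^sub>R p) - c x - Jac c x *v (\<alpha> *\<^sub>R p))"
    using norm_triangle_ineq[of "c x + Jac c x *v (\<alpha> *\<^sub>R p)"
        "c (x + \<alpha> *\<^sub>R p) - c x - Jac c x *v (\<alpha> *\<^sub>R p)"] by simp
  ultimately have "norm (c (x + \<alpha> *\<^sub>R p)) \<le> (1 - \<alpha>) * norm (c x) + L\<^sub>c / 2 * (norm (\<alpha> *\<^sub>R p))\<^sup>2"
    using \<alpha> by simp
  then have "\<pi>' * norm (c (x + \<alpha> *\<^sub>R p)) \<le>
      \<pi>' * ((1 - \<alpha>) * norm (c x) + L\<^sub>c / 2 * (norm (\<alpha> *\<^sub>R p))\<^sup>2)"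
    using penalty_pos by (simp add: mult_left_mono)
  moreover have "(norm (\<alpha> *\<^sub>R p))\<^sup>2 = \<alpha>\<^sup>2 * (norm p)\<^sup>2" by (simp add: power_mult_distrib)
  ultimately show ?thesis
    using f unfolding merit_def Dbar_eq inner_scaleR_right
    by (simp add: distrib_left distrib_right left_diff_distrib right_diff_distrib mult_ac)
qed

text \<open>The Armijo test leaves \<open>(1 - eta A) * \<alpha>\<close> times the model decrease as
  slack for the remainder of order \<open>\<alpha>\<^sup>2 / 2\<close>. Both are compared through
  \<open>E\<close>.\<close>

lemma armijo_below_threshold:
  assumes \<alpha>: "0 < \<alpha>" "\<alpha> \<le> 1" and le: "\<alpha> \<le> step_threshold"
  shows "armijo A f c x p \<pi>' \<alpha>"
proof -
  define E where "E = norm (c x) + (norm w)\<^sup>2"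
  have "0 \<le> E" by (simp add: E_def)
  have "descent_const * E \<le> rho A * \<pi>' * norm (c x) + gamma_tan A * (norm w)\<^sup>2"
  proof -
    have "pi_init A * rho A \<le> rho A * \<pi>'"
      using penalty_bounds \<pi>_ge param_bounds by (simp add: mult.commute)
    then have "descent_const * norm (c x) \<le> rho A * \<pi>' * norm (c x)"
      by (intro mult_right_mono) (auto simp: descent_const_def)
    moreover have "descent_const * (norm w)\<^sup>2 \<le> gamma_tan A * (norm w)\<^sup>2"
      by (intro mult_right_mono) (auto simp: descent_const_def)
    ultimately show ?thesis by (simp add: E_def distrib_left)
  qed
  then have D: "descent_const * E \<le> - Dbar f c x p \<pi>'" using Dbar_le by linarith
  have "\<alpha> * curvature_const \<le> 2 * (1 - eta A) * descent_const"
  proof (cases "curvature_const = 0")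
    case True
    then show ?thesis using descent_const_pos param_bounds by simp
  next
    case False
    then show ?thesis
      using le curvature_const_nonneg by (simp add: step_threshold_def pos_le_divide_eq)
  qed
  then have "\<alpha> * curvature_const * E \<le> 2 * (1 - eta A) * (descent_const * E)"
    using \<open>0 \<le> E\<close> by (metis mult.assoc mult_right_mono)
  also have "\<dots> \<le> 2 * (1 - eta A) * (- Dbar f c x p \<pi>')"
    using D param_bounds by (intro mult_left_mono) auto
  finally have 1: "\<alpha> * (curvature_const * E) \<le> 2 * (1 - eta A) * (- Dbar f c x p \<pi>')"
    by (simp add: mult.assoc)
  have "(L\<^sub>f + \<pi>' * L\<^sub>c) * (norm p)\<^sup>2 \<le>
      (pi_bar A \<kappa>\<^sub>g \<sigma>\<^sub>J * L\<^sub>c + L\<^sub>f) * (max 1 (\<kappa>\<^sub>c / \<sigma>\<^sub>J\<^sup>2) * E)"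
    unfolding E_def
  proof (rule mult_mono[OF _ norm_step_le])
    show "L\<^sub>f + \<pi>' * L\<^sub>c \<le> pi_bar A \<kappa>\<^sub>g \<sigma>\<^sub>J * L\<^sub>c + L\<^sub>f"
      using mult_right_mono[OF penalty_bounds(2) L\<^sub>c_nonneg] by simp
    show "0 \<le> pi_bar A \<kappa>\<^sub>g \<sigma>\<^sub>J * L\<^sub>c + L\<^sub>f"
      using pi_bar_pos L\<^sub>c_nonneg L\<^sub>f_nonneg by simp
  qed simp
  also have "\<dots> = curvature_const * E" by (simp add: curvature_const_def)
  finally have "\<alpha> * ((L\<^sub>f + \<pi>' * L\<^sub>c) * (norm p)\<^sup>2) \<le> \<alpha> * (curvature_const * E)"
    using \<alpha> by (intro mult_left_mono) auto
  with 1 have "\<alpha> * ((L\<^sub>f + \<pi>' * L\<^sub>c) * (norm p)\<^sup>2) \<le> 2 * (1 - eta A) * (- Dbar f c x p \<pi>')" by linarith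
  then have "\<alpha> / 2 * (\<alpha> * ((L\<^sub>f + \<pi>' * L\<^sub>c) * (norm p)\<^sup>2)) \<le>
      \<alpha> / 2 * (2 * (1 - eta A) * (- Dbar f c x p \<pi>'))"
    using \<alpha> by (intro mult_left_mono) auto
  then show ?thesis
    using merit_le[of \<alpha>] \<alpha> unfolding armijo_def by (simp add: power2_eq_square algebra_simps)
qed

text \<open>The Armijo inequality divided by \<open>\<pi>'\<close> compares potentials at the new
  parameter. Returning to \<open>\<pi>\<close> costs nothing as
  \<open>f x \<ge> f\<^sub>l\<^sub>o\<^sub>w\<close>, and \<open>\<pi>' \<le> pi_bar\<close> makes
  the tangential gain uniform.\<close>

lemma potential_decrease:
  assumes armijo: "armijo A f c x p \<pi>' \<alpha>" and \<alpha>: "alpha_bar A L\<^sub>f L\<^sub>c \<kappa>\<^sub>g \<kappa>\<^sub>c \<sigma>\<^sub>J \<le> \<alpha>"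
    and w_large: "omega_tan A \<kappa> * norm (null_proj (Jac c x) *v grad f x) \<le> norm w"
  shows "potential (x + \<alpha> *\<^sub>R p) \<pi>' \<le> potential x \<pi> - decrease \<kappa>"
proof -
  define a where "a = alpha_bar A L\<^sub>f L\<^sub>c \<kappa>\<^sub>g \<kappa>\<^sub>c \<sigma>\<^sub>J * eta A"
  define E where "E = rho A * \<pi>' * norm (c x) + gamma_tan A * (norm w)\<^sup>2"
  have "0 < a" using alpha_bar_pos param_bounds by (simp add: a_def)
  have "0 \<le> E" using penalty_pos gamma_tan_pos param_bounds by (simp add: E_def)
  have "a * E \<le> \<alpha> * eta A * E"
    unfolding a_def using \<alpha> param_bounds \<open>0 \<le> E\<close> by (intro mult_right_mono) auto
  also have "\<dots> \<le> \<alpha> * eta A * - Dbar f c x p \<pi>'"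
    using Dbar_le \<alpha> alpha_bar_pos param_bounds by (intro mult_left_mono) (auto simp: E_def)
  finally have *: "merit f c (x + \<alpha> *\<^sub>R p) \<pi>' \<le> merit f c x \<pi>' - a * E"
    using armijo by (simp add: armijo_def)
  have "potential (x + \<alpha> *\<^sub>R p) \<pi>' = (merit f c (x + \<alpha> *\<^sub>R p) \<pi>' - f\<^sub>l\<^sub>o\<^sub>w) / \<pi>'"
    using penalty_pos by (simp add: potential_def merit_def field_simps)
  also have "\<dots> \<le> (merit f c x \<pi>' - a * E - f\<^sub>l\<^sub>o\<^sub>w) / \<pi>'"
    using * penalty_pos by (intro divide_right_mono) auto
  also have "\<dots> = potential x \<pi>' - a * (E / \<pi>')"
    using penalty_pos by (simp add: potential_def merit_def field_simps)
  finally have "potential (x + \<alpha> *\<^sub>R p) \<pi>' \<le> potential x \<pi>' - a * (E / \<pi>')" .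
  moreover have "potential x \<pi>' \<le> potential x \<pi>"
    using f_ge[OF iterate[OF state]] penalty_bounds(1) \<pi>_ge param_bounds
    by (simp add: potential_def divide_left_mono mult_pos_pos)
  moreover have "decrease \<kappa> \<le> a * (E / \<pi>')"
  proof -
    have "rho A * norm (c x) + gamma_tan A * (norm w)\<^sup>2 / pi_bar A \<kappa>\<^sub>g \<sigma>\<^sub>J \<le>
        rho A * norm (c x) + gamma_tan A * (norm w)\<^sup>2 / \<pi>'"
      using penalty_pos penalty_bounds(2) gamma_tan_pos
      by (intro add_left_mono divide_left_mono) (auto intro: less_le_trans)
    also have "\<dots> = E / \<pi>'" using penalty_pos by (simp add: E_def add_divide_distrib)
    finally have "a * (rho A * norm (c x) + gamma_tan A * (norm w)\<^sup>2 / pi_bar A \<kappa>\<^sub>g \<sigma>\<^sub>J) \<le> a * (E / \<pi>')"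
      using \<open>0 < a\<close> by (intro mult_left_mono) auto
    then show ?thesis using decrease_le[OF active w_large] by (simp add: a_def)
  qed
  ultimately show ?thesis by linarith
qed

end

lemma next_state:
  assumes bound: "lagrangian_hess_bound A f c ls Z \<kappa>"
  obtains x' l' where "dpd_state A f c ls Z (Suc k) = Some (x', l', \<pi>')"
    "potential x' \<pi>' \<le> potential x \<pi> - decrease \<kappa>"
proof -
  have "opnorm (dpd_hess f c (ls k) x) \<le> \<kappa>"
    using bound state active by (auto simp: lagrangian_hess_bound_def dpd_active_def)
  then obtain w where w: "dpd_tangential A f c (ls k) (Z k) x = Some w"
    "null_proj (Jac c x) *v w = w" "grad f x \<bullet> w \<le> - (gamma_tan A * (norm w)\<^sup>2)"
    "omega_tan A \<kappa> * norm (null_proj (Jac c x) *v grad f x) \<le> norm w"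
    unfolding dpd_tangential_def gamma_tan_def
    using projected_cr_properties[OF dpd_hess_self_adjoint param_bounds(4) param_bounds(3) _
        omega_tan_def[of A \<kappa>]] by metis
  obtain \<alpha> where \<alpha>: "backtracking A f c x (v + w) \<pi>' = Some \<alpha>"
    "armijo A f c x (v + w) \<pi>' \<alpha>" "min 1 (theta A * step_threshold) \<le> \<alpha>"
    using armijo_below_threshold[OF w(1-3)]
    by (rule backtracking_obtains[OF param_bounds(9,10) step_threshold_pos])
  show thesis
  proof
    show "dpd_state A f c ls Z (Suc k) = Some (x + \<alpha> *\<^sub>R (v + w), dpd_multiplier f c (ls k) x, \<pi>')"
      using state active w(1) \<alpha>(1) by (simp add: Let_def)
    show "potential (x + \<alpha> *\<^sub>R (v + w)) \<pi>' \<le> potential x \<pi> - decrease \<kappa>"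
      using potential_decrease[OF w(1-3) \<alpha>(2) _ w(4)] \<alpha>(3) by (simp add: alpha_bar_eq)
  qed
qed

end

text \<open>\<open>dpd_state\<close> is \<open>None\<close> after a stop, hence the alternative. The
  bounds on \<open>\<pi>\<close> belong to the invariant because the analysis of one iteration
  assumes them.\<close>

lemma progress:
  assumes bound: "lagrangian_hess_bound A f c ls Z \<kappa>"
  shows "(\<exists>k<n. \<exists>x l \<pi>. dpd_state A f c ls Z k = Some (x, l, \<pi>) \<and> dpd_stop A f c x) \<or>
    (\<exists>x l \<pi>. dpd_state A f c ls Z n = Some (x, l, \<pi>) \<and> pi_init A \<le> \<pi> \<and> \<pi> \<le> pi_bar A \<kappa>\<^sub>g \<sigma>\<^sub>J \<and>
      potential x \<pi> \<le> potential (x_init A) (pi_init A) - real n * decrease \<kappa>)"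
proof (induction n)
  case 0
  show ?case by (simp add: pi_bar_def)
next
  case (Suc n)
  show ?case
  proof (cases "\<exists>k<Suc n. \<exists>x l \<pi>. dpd_state A f c ls Z k = Some (x, l, \<pi>) \<and> dpd_stop A f c x")
    case False
    then obtain x l \<pi> where s: "dpd_state A f c ls Z n = Some (x, l, \<pi>)" "\<not> dpd_stop A f c x"
      "pi_init A \<le> \<pi>" "\<pi> \<le> pi_bar A \<kappa>\<^sub>g \<sigma>\<^sub>J"
      "potential x \<pi> \<le> potential (x_init A) (pi_init A) - real n * decrease \<kappa>"
      using Suc.IH by (meson less_Suc_eq)
    obtain x' l' where "dpd_state A f c ls Z (Suc n) = Some (x', l', dpd_penalty A f c x \<pi>)"
      "potential x' (dpd_penalty A f c x \<pi>) \<le> potential x \<pi> - decrease \<kappa>"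
      using next_state[OF s(1-4) bound] by blast
    then show ?thesis
      using penalty_bounds[OF s(1-4)] s(3,5) by (intro disjI2) (auto simp: distrib_right)
  qed blast
qed

lemma reaches_stop:
  assumes bound: "lagrangian_hess_bound A f c ls Z \<kappa>"
  obtains k x l \<pi> where "int k \<le> \<lceil>potential (x_init A) (pi_init A) / decrease \<kappa>\<rceil>"
    "dpd_state A f c ls Z k = Some (x, l, \<pi>)" "dpd_stop A f c x"
proof -
  define q where "q = potential (x_init A) (pi_init A) / decrease \<kappa>"
  have "x_init A \<in> iterates_and_trials A f c ls Z" by (rule iterate[of 0]) simp
  then have "0 \<le> q"
    using f_ge decrease_pos[of \<kappa>] param_bounds by (simp add: q_def potential_def)
  \<comment> \<open>The successor makes \<open>n\<close> exceed the quotient even if that is an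
    integer, so a run without a stop would have negative potential; \<open>k < n\<close> then gives
    the ceiling itself.\<close>
  define n where "n = Suc (nat \<lceil>q\<rceil>)"
  have "q < real n" using \<open>0 \<le> q\<close> unfolding n_def by linarith
  then have "potential (x_init A) (pi_init A) < real n * decrease \<kappa>"
    using decrease_pos[of \<kappa>] by (simp add: q_def pos_divide_less_eq)
  moreover have "0 \<le> potential x \<pi>"
    if "dpd_state A f c ls Z n = Some (x, l, \<pi>)" "pi_init A \<le> \<pi>" for x l \<pi>
    using f_ge[OF iterate[OF that(1)]] that(2) param_bounds by (simp add: potential_def)
  ultimately obtain k x l \<pi> where k: "k < n" "dpd_state A f c ls Z k = Some (x, l, \<pi>)" "dpd_stop A f c x"
    using progress[OF bound, of n] by fastforce
  have "int k \<le> \<lceil>q\<rceil>" using k(1) \<open>0 \<le> q\<close> unfolding n_def by linarith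
  then show thesis using that k unfolding q_def by blast
qed

end

theorem theorem1:
  fixes f :: "real^'d \<Rightarrow> real" and c :: "real^'d \<Rightarrow> real^'c"
    and A :: "('d, 'c) dpd_params"
    and ls :: "nat \<Rightarrow> bool" and Z :: "nat \<Rightarrow> (real^'d) list"
    and X D :: "(real^'d) set"
    and \<sigma>\<^sub>J \<kappa>\<^sub>J L\<^sub>f L\<^sub>c f\<^sub>l\<^sub>o\<^sub>w \<kappa>\<^sub>g \<kappa>\<^sub>c :: real
  assumes "C2 f" and "\<And>i. C2 (\<lambda>x. c x $ i)"
    and "valid_params A"
    and Z: "\<And>k x. (k, x) \<in> dpd_active A f c ls Z \<Longrightarrow> is_orthonormal_factor (Z k) (null_proj (Jac c x))"
    and X: "X = iterates_and_trials A f c ls Z"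
    and D: "X \<union> search_segments A f c ls Z \<subseteq> D"
    and "0 < \<sigma>\<^sub>J" and "\<sigma>\<^sub>J \<le> \<kappa>\<^sub>J"
    and sing: "\<And>x. x \<in> X \<Longrightarrow>
      \<sigma>\<^sub>J \<le> singular_value (Jac c x) CARD('c) \<and>
      singular_value (Jac c x) CARD('c) \<le> singular_value (Jac c x) 1 \<and>
      singular_value (Jac c x) 1 \<le> \<kappa>\<^sub>J"
    and "L\<^sub>f-lipschitz_on D (grad f)"
    and "0 \<le> L\<^sub>c"
    and "\<And>x y. x \<in> D \<Longrightarrow> y \<in> D \<Longrightarrow> opnorm (Jac c x - Jac c y) \<le> L\<^sub>c * dist x y"
    and "\<And>x. x \<in> X \<Longrightarrow> f\<^sub>l\<^sub>o\<^sub>w \<le> f x"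
    and "\<And>x. x \<in> X \<Longrightarrow> norm (grad f x) \<le> \<kappa>\<^sub>g"
    and "\<And>x. x \<in> X \<Longrightarrow> norm (c x) \<le> \<kappa>\<^sub>c"
  shows "(open D \<longrightarrow> (\<exists>\<kappa>\<^sub>L. lagrangian_hess_bound A f c ls Z \<kappa>\<^sub>L)) \<and>
    (\<forall>\<kappa>\<^sub>L. lagrangian_hess_bound A f c ls Z \<kappa>\<^sub>L \<longrightarrow>
      (let \<Gamma>\<^sub>c = Gamma_c A L\<^sub>f L\<^sub>c \<kappa>\<^sub>g \<kappa>\<^sub>c \<sigma>\<^sub>J;
           \<Gamma>\<^sub>p = Gamma_p A L\<^sub>f L\<^sub>c \<kappa>\<^sub>g \<kappa>\<^sub>c \<sigma>\<^sub>J \<kappa>\<^sub>L;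
           K = \<lceil>((f (x_init A) - f\<^sub>l\<^sub>o\<^sub>w) / pi_init A + norm (c (x_init A))) /
                 (min \<Gamma>\<^sub>c \<Gamma>\<^sub>p * min (eps_c A) ((eps_p A)\<^sup>2))\<rceil> + 1
       in \<Gamma>\<^sub>c > 0 \<and> \<Gamma>\<^sub>p > 0 \<and>
          (\<exists>k x l \<pi>. int (k + 1) \<le> K \<and> dpd_state A f c ls Z k = Some (x, l, \<pi>) \<and>
             norm (c x) \<le> eps_c A \<and>
             norm (null_proj (Jac c x) *v grad f x) \<le> eps_p A)))"
proof -
  interpret dpd_run f c A ls Z D \<sigma>\<^sub>J L\<^sub>f L\<^sub>c f\<^sub>l\<^sub>o\<^sub>w \<kappa>\<^sub>g \<kappa>\<^sub>c
    by unfold_locales (use assms in \<open>simp_all add: X\<close>)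
  show ?thesis
  proof (intro conjI impI allI)
    show "\<exists>\<kappa>\<^sub>L. lagrangian_hess_bound A f c ls Z \<kappa>\<^sub>L" if "open D"
      using lagrangian_hess_bounded[OF that] by blast
  next
    fix \<kappa>\<^sub>L assume "lagrangian_hess_bound A f c ls Z \<kappa>\<^sub>L"
    then obtain k x l \<pi> where "int k \<le> \<lceil>potential (x_init A) (pi_init A) / decrease \<kappa>\<^sub>L\<rceil>"
      "dpd_state A f c ls Z k = Some (x, l, \<pi>)" "dpd_stop A f c x"
      by (rule reaches_stop)
    \<comment> \<open>Indices start at 0, so the point of index \<open>k\<close> is charged
      \<open>k + 1\<close> iterations; this is the final 1 in \<open>K\<close>.\<close>
    then have "\<exists>k x l \<pi>. int (k + 1) \<le> \<lceil>potential (x_init A) (pi_init A) / decrease \<kappa>\<^sub>L\<rceil> + 1 \<and>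
        dpd_state A f c ls Z k = Some (x, l, \<pi>) \<and> norm (c x) \<le> eps_c A \<and>
        norm (null_proj (Jac c x) *v grad f x) \<le> eps_p A"
      unfolding dpd_stop_def by (intro exI[of _ k]) auto
    then show "let \<Gamma>\<^sub>c = Gamma_c A L\<^sub>f L\<^sub>c \<kappa>\<^sub>g \<kappa>\<^sub>c \<sigma>\<^sub>J;
           \<Gamma>\<^sub>p = Gamma_p A L\<^sub>f L\<^sub>c \<kappa>\<^sub>g \<kappa>\<^sub>c \<sigma>\<^sub>J \<kappa>\<^sub>L;
           K = \<lceil>((f (x_init A) - f\<^sub>l\<^sub>o\<^sub>w) / pi_init A + norm (c (x_init A))) /
                 (min \<Gamma>\<^sub>c \<Gamma>\<^sub>p * min (eps_c A) ((eps_p A)\<^sup>2))\<rceil> + 1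
       in \<Gamma>\<^sub>c > 0 \<and> \<Gamma>\<^sub>p > 0 \<and>
          (\<exists>k x l \<pi>. int (k + 1) \<le> K \<and> dpd_state A f c ls Z k = Some (x, l, \<pi>) \<and>
             norm (c x) \<le> eps_c A \<and>
             norm (null_proj (Jac c x) *v grad f x) \<le> eps_p A)"
      using Gamma_c_pos Gamma_p_pos unfolding Let_def potential_def decrease_def by blast
  qed
qed

end
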